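(* Let $M$ be a submanifold of $\mathcal{E}$ with a metric operator $g: M\to L(\mathcal{E},\mathcal{E})$, and let $\Gamma: M\to L(\mathcal{E}\otimes\mathcal{E},\mathcal{E})$ be a Christoffel function of $g$. Let $x\in M$ and let $\xi,\eta,\phi\in T_xM$. Then the Riemannian curvature of $M$ at $x$ is given by each of the following formulas (all expressions evaluated at $x$): $$R^M_{\xi,\eta}\phi = -(D_{\xi}\Gamma)(\eta,\phi)+(D_{\eta}\Gamma)(\xi,\phi)-\Gamma(\xi,\Gamma(\eta,\phi))+\Gamma(\eta,\Gamma(\xi,\phi)),$$ $$R^M_{\xi,\eta}\phi = -(D_{\xi}\Gamma)(\eta,\phi)+(D_{\eta}\Gamma)(\xi,\phi)-\Gamma(\Gamma(\phi,\eta),\xi)+\Gamma(\Gamma(\phi,\xi),\eta).$$ Moreover, with $\mathring{\Gamma}(\xi,\phi)=(D_{\xi}\Pi)\phi+\Gamma(\xi,\phi)$, $$R^M_{\xi,\eta}\phi = -(D_{\xi}\mathring{\Gamma})(\eta,\phi)+(D_{\eta}\mathring{\Gamma})(\xi,\phi)-\Gamma(\xi,\Gamma(\eta,\phi))+\Gamma(\eta,\Gamma(\xi,\phi)).$$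
   Context: $\mathcal{E}$ is a finite-dimensional real inner product space with inner product $\langle\cdot,\cdot\rangle_{\mathcal{E}}$. $M\subset\mathcal{E}$ is a differentiably embedded submanifold, so each tangent space $T_xM$ is a subspace of $\mathcal{E}$ and vector fields on $M$ are identified with $\mathcal{E}$-valued functions. $M$ carries a Riemannian metric (not necessarily induced from $\mathcal{E}$). A metric operator is a smooth map $g:M\to L(\mathcal{E},\mathcal{E})$ such that each $g_x$ is (self-adjoint) positive-definite and $\langle\xi,g_x\eta\rangle_{\mathcal{E}}$ is the Riemannian inner product of $\xi,\eta\in T_xM$. $\Pi_x$ denotes the projection of $\mathcal{E}$ onto $T_xM$ that is orthogonal for the inner product $\langle\cdot,g_x\cdot\rangle_{\mathcal{E}}$; $\Pi$ is a smooth function $M\to L(\mathcal{E},\mathcal{E})$. For a function on $M$ with values in a vector space, $D_\xi$ denotes its directional derivative. A Christoffel function of $g$ is a smooth map $\Gamma:M\to L(\mathcal{E}\otimes\mathcal{E},\mathcal{E})$ (bilinear maps $\mathcal{E}\times\mathcal{E}\to\mathcal{E}$) such that $(\nabla_XY)_x=(D_XY)_x+\Gamma(X_x,Y_x)_x$ for all vector fields $X,Y$ on $M$ and all $x\in M$, where $\nabla$ is the Levi-Civita connection. $(D_\xi\Gamma)(\eta,\phi)$ is the directional derivative of the operator-valued function $\Gamma$, evaluated on the fixed vectors $\eta,\phi\in\mathcal{E}$. $\mathring{\Gamma}:M\to L(\mathcal{E}\otimes\mathcal{E},\mathcal{E})$ is a smooth map satisfying $\mathring{\Gamma}(\xi,\omega)_x=(D_\xi\Pi)_x\omega+\Gamma(\xi,\omega)_x$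 for $\xi\in T_xM$, $\omega\in\mathcal{E}$. Curvature sign convention: $R_{X,Y}Z=\nabla_{[X,Y]}Z-\nabla_X\nabla_YZ+\nabla_Y\nabla_XZ$.
   Formalization: The second formula is proved assuming Γ(ω,ζ)=Γ(ζ,ω) at x for tangent ζ and all ω in E; without this it is false, e.g. on S² in R³ with g=id and Γ(a,b)=⟨a,b⟩x+⟨x,a⟩b it gives twice the curvature. *)

theory Defs
  imports "HOL-Analysis.Analysis"
begin

section \<open>Smooth maps\<close>

text \<open>Only used for open \<open>S\<close> in a finite-dimensional space, where continuity of all directional
  derivatives up to order \<open>k\<close> is continuity of the Frechet derivatives up to order \<open>k\<close>.
  Directional derivatives keep the codomain fixed, so the recursion is well typed.\<close>

primrec Ck_on :: "nat \<Rightarrow> ('a::real_normed_vector \<Rightarrow> 'b::real_normed_vector) \<Rightarrow> 'a set \<Rightarrow> bool" where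
  "Ck_on 0 f S \<longleftrightarrow> continuous_on S f"
| "Ck_on (Suc k) f S \<longleftrightarrow>
     (\<forall>x\<in>S. f differentiable (at x)) \<and> (\<forall>v. Ck_on k (\<lambda>x. frechet_derivative f (at x) v) S)"

definition smooth_on_open :: "('a::euclidean_space \<Rightarrow> 'b::real_normed_vector) \<Rightarrow> 'a set \<Rightarrow> bool" where
  "smooth_on_open f S \<longleftrightarrow> open S \<and> (\<forall>k. Ck_on k f S)"

section \<open>Embedded submanifolds of a Euclidean space\<close>

text \<open>Slice charts: near each of its points, \<open>M\<close> is straightened to a \<open>d\<close>-dimensional linear
  subspace by a diffeomorphism between open subsets of the ambient space.\<close>

definition embedded_submanifold :: "'e::euclidean_space set \<Rightarrow> bool" where
  "embedded_submanifold M \<longleftrightarrow>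
     (\<exists>d. \<forall>x\<in>M. \<exists>U V S. \<exists>p q :: 'e \<Rightarrow> 'e. x \<in> U \<and> smooth_on_open p U \<and> smooth_on_open q V \<and>
        homeomorphism U V p q \<and> subspace S \<and> dim S = d \<and> p ` (U \<inter> M) = V \<inter> S)"

text \<open>Functions on \<open>M\<close> are represented by functions on the ambient space whose values off \<open>M\<close> are
  irrelevant. A function on an embedded submanifold is smooth iff it locally extends to a smooth
  function on an open set of the ambient space.\<close>

definition smooth_on_mfd :: "'e::euclidean_space set \<Rightarrow> ('e \<Rightarrow> 'v::real_normed_vector) \<Rightarrow> bool" where
  "smooth_on_mfd M f \<longleftrightarrow>
     (\<forall>x\<in>M. \<exists>U F. x \<in> U \<and> smooth_on_open F U \<and> (\<forall>y\<in>U \<inter> M. F y = f y))"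

definition curve_through :: "'e::euclidean_space set \<Rightarrow> 'e \<Rightarrow> 'e \<Rightarrow> (real \<Rightarrow> 'e) \<Rightarrow> bool" where
  "curve_through M x \<xi> c \<longleftrightarrow>
     (\<exists>e>0. smooth_on_open c {-e<..<e} \<and> c ` {-e<..<e} \<subseteq> M) \<and>
     c 0 = x \<and> (c has_vector_derivative \<xi>) (at 0)"

definition tangent_space :: "'e::euclidean_space set \<Rightarrow> 'e \<Rightarrow> 'e set" where
  "tangent_space M x = {\<xi>. \<exists>c. curve_through M x \<xi> c}"

text \<open>\<open>dir_deriv M f x \<xi>\<close> is \<open>(D\<^sub>\<xi> f)\<^sub>x\<close>, for \<open>f\<close> smooth on \<open>M\<close> and \<open>\<xi>\<close> tangent to \<open>M\<close> at \<open>x\<close>.\<close>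

definition dir_deriv ::
    "'e::euclidean_space set \<Rightarrow> ('e \<Rightarrow> 'v::real_normed_vector) \<Rightarrow> 'e \<Rightarrow> 'e \<Rightarrow> 'v" where
  "dir_deriv M f x \<xi> =
     (THE d. \<forall>c. curve_through M x \<xi> c \<longrightarrow> ((f \<circ> c) has_vector_derivative d) (at 0))"

definition vector_field :: "'e::euclidean_space set \<Rightarrow> ('e \<Rightarrow> 'e) \<Rightarrow> bool" where
  "vector_field M X \<longleftrightarrow> smooth_on_mfd M X \<and> (\<forall>x\<in>M. X x \<in> tangent_space M x)"

text \<open>The bracket as a commutator of derivations: \<open>[X,Y] f = X (Y f) - Y (X f)\<close>.\<close>

definition lie_bracket :: "'e::euclidean_space set \<Rightarrow> ('e \<Rightarrow> 'e) \<Rightarrow> ('e \<Rightarrow> 'e) \<Rightarrow> 'e \<Rightarrow> 'e" where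
  "lie_bracket M X Y x =
     (THE w. w \<in> tangent_space M x \<and>
        (\<forall>f::'e \<Rightarrow> real. smooth_on_mfd M f \<longrightarrow>
           dir_deriv M f x w = dir_deriv M (\<lambda>y. dir_deriv M f y (Y y)) x (X x)
                             - dir_deriv M (\<lambda>y. dir_deriv M f y (X y)) x (Y x)))"

section \<open>Metric operators and the Levi-Civita connection\<close>

text \<open>The Riemannian metric on \<open>M\<close> is \<open>\<xi> \<bullet> g x \<eta>\<close> for \<open>\<xi>, \<eta>\<close> tangent at \<open>x\<close>.\<close>

definition metric_operator ::
    "'e::euclidean_space set \<Rightarrow> ('e \<Rightarrow> 'e \<Rightarrow>\<^sub>L 'e) \<Rightarrow> bool" where
  "metric_operator M g \<longleftrightarrow> smooth_on_mfd M g \<and>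
     (\<forall>x\<in>M. (\<forall>v w. v \<bullet> g x w = g x v \<bullet> w) \<and> (\<forall>v. v \<noteq> 0 \<longrightarrow> 0 < v \<bullet> g x v))"

definition tangent_proj ::
    "'e::euclidean_space set \<Rightarrow> ('e \<Rightarrow> 'e \<Rightarrow>\<^sub>L 'e) \<Rightarrow> 'e \<Rightarrow> 'e \<Rightarrow>\<^sub>L 'e" where
  "tangent_proj M g x =
     (THE P::'e \<Rightarrow>\<^sub>L 'e. \<forall>\<omega>. P \<omega> \<in> tangent_space M x \<and>
        (\<forall>\<zeta>\<in>tangent_space M x. (\<omega> - P \<omega>) \<bullet> g x \<zeta> = 0))"

definition affine_connection ::
    "'e::euclidean_space set \<Rightarrow> (('e \<Rightarrow> 'e) \<Rightarrow> ('e \<Rightarrow> 'e) \<Rightarrow> 'e \<Rightarrow> 'e) \<Rightarrow> bool" where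
  "affine_connection M nabla \<longleftrightarrow>
     (\<forall>X Y. vector_field M X \<longrightarrow> vector_field M Y \<longrightarrow> vector_field M (nabla X Y)) \<and>
     (\<forall>X X' Y. vector_field M X \<longrightarrow> vector_field M X' \<longrightarrow> vector_field M Y \<longrightarrow>
        (\<forall>x\<in>M. nabla (\<lambda>y. X y + X' y) Y x = nabla X Y x + nabla X' Y x)) \<and>
     (\<forall>f X Y. smooth_on_mfd M f \<longrightarrow> vector_field M X \<longrightarrow> vector_field M Y \<longrightarrow>
        (\<forall>x\<in>M. nabla (\<lambda>y. f y *\<^sub>R X y) Y x = f x *\<^sub>R nabla X Y x)) \<and>
     (\<forall>X Y Y'. vector_field M X \<longrightarrow> vector_field M Y \<longrightarrow> vector_field M Y' \<longrightarrow>
        (\<forall>x\<in>M. nabla X (\<lambda>y. Y y + Y' y) x = nabla X Y x + nabla X Y' x)) \<and>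
     (\<forall>f X Y. smooth_on_mfd M f \<longrightarrow> vector_field M X \<longrightarrow> vector_field M Y \<longrightarrow>
        (\<forall>x\<in>M. nabla X (\<lambda>y. f y *\<^sub>R Y y) x =
           dir_deriv M f x (X x) *\<^sub>R Y x + f x *\<^sub>R nabla X Y x))"

definition levi_civita ::
    "'e::euclidean_space set \<Rightarrow> ('e \<Rightarrow> 'e \<Rightarrow>\<^sub>L 'e) \<Rightarrow>
     (('e \<Rightarrow> 'e) \<Rightarrow> ('e \<Rightarrow> 'e) \<Rightarrow> 'e \<Rightarrow> 'e) \<Rightarrow> bool" where
  "levi_civita M g nabla \<longleftrightarrow> affine_connection M nabla \<and>
     (\<forall>X Y. vector_field M X \<longrightarrow> vector_field M Y \<longrightarrow>
        (\<forall>x\<in>M. nabla X Y x - nabla Y X x = lie_bracket M X Y x)) \<and>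
     (\<forall>X Y Z. vector_field M X \<longrightarrow> vector_field M Y \<longrightarrow> vector_field M Z \<longrightarrow>
        (\<forall>x\<in>M. dir_deriv M (\<lambda>y. Y y \<bullet> g y (Z y)) x (X x) =
           nabla X Y x \<bullet> g x (Z x) + Y x \<bullet> g x (nabla X Z x)))"

text \<open>The value at \<open>x\<close> of the curvature \<open>R\<^bsub>X,Y\<^esub> Z\<close>, which depends only on \<open>X x, Y x, Z x\<close>.
  Sign convention: the opposite of \<open>[\<nabla>\<^sub>X, \<nabla>\<^sub>Y] - \<nabla>\<^bsub>[X,Y]\<^esub>\<close>.\<close>

definition riem_curv ::
    "'e::euclidean_space set \<Rightarrow> (('e \<Rightarrow> 'e) \<Rightarrow> ('e \<Rightarrow> 'e) \<Rightarrow> 'e \<Rightarrow> 'e) \<Rightarrow>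
     'e \<Rightarrow> 'e \<Rightarrow> 'e \<Rightarrow> 'e \<Rightarrow> 'e" where
  "riem_curv M nabla x \<xi> \<eta> \<phi> =
     (THE r. \<forall>X Y Z. vector_field M X \<longrightarrow> vector_field M Y \<longrightarrow> vector_field M Z \<longrightarrow>
        X x = \<xi> \<longrightarrow> Y x = \<eta> \<longrightarrow> Z x = \<phi> \<longrightarrow>
        r = nabla (lie_bracket M X Y) Z x - nabla X (nabla Y Z) x + nabla Y (nabla X Z) x)"

section \<open>Christoffel functions\<close>

text \<open>Bilinear maps \<open>E \<times> E \<rightarrow> E\<close> are curried.\<close>

definition christoffel_function ::
    "'e::euclidean_space set \<Rightarrow> (('e \<Rightarrow> 'e) \<Rightarrow> ('e \<Rightarrow> 'e) \<Rightarrow> 'e \<Rightarrow> 'e) \<Rightarrow>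
     ('e \<Rightarrow> 'e \<Rightarrow>\<^sub>L 'e \<Rightarrow>\<^sub>L 'e) \<Rightarrow> bool" where
  "christoffel_function M nabla \<Gamma> \<longleftrightarrow> smooth_on_mfd M \<Gamma> \<and>
     (\<forall>X Y. vector_field M X \<longrightarrow> vector_field M Y \<longrightarrow>
        (\<forall>x\<in>M. nabla X Y x = dir_deriv M Y x (X x) + \<Gamma> x (X x) (Y x)))"

definition ring_christoffel ::
    "'e::euclidean_space set \<Rightarrow> ('e \<Rightarrow> 'e \<Rightarrow>\<^sub>L 'e) \<Rightarrow> ('e \<Rightarrow> 'e \<Rightarrow>\<^sub>L 'e \<Rightarrow>\<^sub>L 'e) \<Rightarrow>
     ('e \<Rightarrow> 'e \<Rightarrow>\<^sub>L 'e \<Rightarrow>\<^sub>L 'e) \<Rightarrow> bool" where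
  "ring_christoffel M g \<Gamma> \<Gamma>r \<longleftrightarrow> smooth_on_mfd M \<Gamma>r \<and>
     (\<forall>x\<in>M. \<forall>\<xi>\<in>tangent_space M x. \<forall>\<omega>.
        \<Gamma>r x \<xi> \<omega> = dir_deriv M (tangent_proj M g) x \<xi> \<omega> + \<Gamma> x \<xi> \<omega>)"

text \<open>Vanishing torsion makes \<open>\<Gamma> x\<close> symmetric on tangent vectors only, and does not constrain
  \<open>\<Gamma> x \<omega> \<xi>\<close> for \<open>\<omega>\<close> not tangent. The curvature formula with the terms \<open>\<Gamma> (\<Gamma> (\<phi>, \<eta>), \<xi>)\<close> needs
  symmetry between a tangent and an ambient vector. Without it that formula fails: on the unit
  sphere in three-space with \<open>g x = id\<close>, the map \<open>\<Gamma> x (\<xi>, \<eta>) = (\<xi> \<bullet> \<eta>) x + (x \<bullet> \<xi>) \<eta>\<close> is a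
  Christoffel function, but the formula yields twice the curvature.\<close>

definition christoffel_symmetric_at ::
    "'e::euclidean_space set \<Rightarrow> ('e \<Rightarrow> 'e \<Rightarrow>\<^sub>L 'e \<Rightarrow>\<^sub>L 'e) \<Rightarrow> 'e \<Rightarrow> bool" where
  "christoffel_symmetric_at M \<Gamma> x \<longleftrightarrow> (\<forall>\<xi>\<in>tangent_space M x. \<forall>\<omega>. \<Gamma> x \<omega> \<xi> = \<Gamma> x \<xi> \<omega>)"

end

theory Submission
  imports Defs
begin

text \<open>The heart of the matter is that the commutator \<open>D\<^sub>X (D\<^sub>Y f) - D\<^sub>Y (D\<^sub>X f)\<close> of two directional
  derivatives along \<open>M\<close> is the directional derivative along the single vector \<open>w = D\<^sub>X Y - D\<^sub>Y X\<close>, and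
  that \<open>w\<close> is tangent (\<open>dir_deriv_commutator\<close>, \<open>commutator_tangent\<close>). Both rest on the symmetry of second
  derivatives in the ambient space (\<open>second_derivative_symmetric\<close>): for the first, the second-order
  terms of a local extension of \<open>f\<close> cancel; for the second, the same cancellation for a local
  equation of \<open>M\<close> shows that its derivative annihilates \<open>w\<close>. Testing with coordinate functions,
  \<open>w\<close> is the Lie bracket of \<open>X\<close> and \<open>Y\<close> (\<open>lie_bracket_eq\<close>).

  Inserting \<open>\<nabla>\<^sub>X Y = D\<^sub>X Y + \<Gamma> (X, Y)\<close> into the definition of the curvature and using the Leibniz rule, all
  derivatives of the fields disappear through this identity, applied to \<open>f = Z\<close>
  (\<open>curvature_of_fields\<close>); this is the first formula. The second is the first with arguments of
  \<open>\<Gamma>\<close> exchanged, one of them tangent in each exchange. For the third, the identity is applied to the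
  tangent projection in place of \<open>Z\<close>: replacing \<open>\<Gamma>\<close> by \<open>\<Gamma>r\<close> leaves the antisymmetrized derivative
  \<open>(D\<^sub>\<xi> \<Gamma>) \<eta> - (D\<^sub>\<eta> \<Gamma>) \<xi>\<close> unchanged (\<open>ring_christoffel_antisymmetrized_derivative\<close>).

  For the curvature at a point to be a well-defined vector, tangent vectors have to extend to vector
  fields. The tangent projection of a constant field does this, and the third formula differentiates
  the projection as well. Its smoothness comes from a Gram-Schmidt process on a local frame of
  tangent fields (\<open>smooth_orthogonal_projection\<close>, \<open>embedded_submanifold_frame\<close>).

  A directional derivative along \<open>M\<close> is handled throughout as the value, on a tangent vector, of a
  Frechet derivative within the set \<open>M\<close> (\<open>dir_deriv_eq\<close>).\<close>

section \<open>Calculus of smooth maps on open sets\<close>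

lemma Ck_on_cong:
  assumes "open S" and "\<And>x. x \<in> S \<Longrightarrow> f x = g x" and "Ck_on k f S"
  shows "Ck_on k g S"
  using assms(2,3)
proof (induction k arbitrary: f g)
  case 0
  then show ?case by (auto cong: continuous_on_cong)
next
  case (Suc k)
  have der: "(g has_derivative frechet_derivative f (at x)) (at x)" if "x \<in> S" for x
  proof (rule has_derivative_transform_within_open[OF _ \<open>open S\<close> that Suc.prems(1)])
    have "f differentiable (at x)"
      using Suc.prems(2) that by simp
    then show "(f has_derivative frechet_derivative f (at x)) (at x)"
      by (simp only: frechet_derivative_works)
  qed
  have eq: "frechet_derivative f (at x) = frechet_derivative g (at x)" if "x \<in> S" for x
    using der[OF that] by (rule frechet_derivative_at)
  have "Ck_on k (\<lambda>x. frechet_derivative g (at x) v) S" for v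
  proof (rule Suc.IH)
    show "Ck_on k (\<lambda>x. frechet_derivative f (at x) v) S"
      using Suc.prems(2) by simp
  qed (simp add: eq)
  moreover have "g differentiable (at x)" if "x \<in> S" for x
    using der[OF that] by (rule differentiableI)
  ultimately show ?case
    by simp
qed

text \<open>Lets every closure property below be proved by exhibiting a derivative that is correct on \<open>S\<close>
  only, instead of computing \<^const>\<open>frechet_derivative\<close>.\<close>

lemma Ck_on_SucI:
  assumes "open S" and "\<And>x. x \<in> S \<Longrightarrow> (f has_derivative f' x) (at x)"
    and "\<And>v. Ck_on k (\<lambda>x. f' x v) S"
  shows "Ck_on (Suc k) f S"
proof -
  have eq: "f' x = frechet_derivative f (at x)" if "x \<in> S" for x
    using assms(2)[OF that] by (rule frechet_derivative_at)
  have "Ck_on k (\<lambda>x. frechet_derivative f (at x) v) S" for v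
    by (rule Ck_on_cong[OF assms(1) _ assms(3)[of v]]) (simp add: eq)
  moreover have "f differentiable (at x)" if "x \<in> S" for x
    using assms(2)[OF that] by (rule differentiableI)
  ultimately show ?thesis
    by simp
qed

lemma Ck_on_Suc_has_derivative:
  assumes "Ck_on (Suc k) f S" "x \<in> S"
  shows "(f has_derivative frechet_derivative f (at x)) (at x)"
  using assms by (auto simp: frechet_derivative_works[symmetric])

lemma Ck_on_Suc_imp:
  assumes "Ck_on (Suc k) f S"
  shows "Ck_on k f S"
  using assms
proof (induction k arbitrary: f)
  case 0
  then show ?case
    by (auto intro!: continuous_at_imp_continuous_on differentiable_imp_continuous_within)
next
  case (Suc k)
  then show ?case
    by (metis Ck_on.simps(2))
qed

lemma Ck_on_subset:
  assumes "Ck_on k f S" "T \<subseteq> S"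
  shows "Ck_on k f T"
  using assms by (induction k arbitrary: f) (auto intro: continuous_on_subset)

lemma Ck_on_const: "open S \<Longrightarrow> Ck_on k (\<lambda>x. c) S"
proof (induction k arbitrary: c)
  case (Suc k)
  then show ?case
    by (intro Ck_on_SucI[where f' = "\<lambda>x v. 0"]) auto
qed auto

lemma Ck_on_linear:
  assumes "bounded_linear L" "open S" "Ck_on k f S"
  shows "Ck_on k (\<lambda>x. L (f x)) S"
  using assms(3)
proof (induction k arbitrary: f)
  case 0
  then show ?case
    using assms(1) by (auto intro: bounded_linear.continuous_on)
next
  case (Suc k)
  then show ?case
    using assms(1,2) bounded_linear.has_derivative[OF assms(1) Ck_on_Suc_has_derivative[OF Suc.prems]]
    by (intro Ck_on_SucI[where f' = "\<lambda>x v. L (frechet_derivative f (at x) v)"]) auto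
qed

lemma Ck_on_ident: "open S \<Longrightarrow> Ck_on k (\<lambda>x. x) S"
  by (cases k) (auto intro!: Ck_on_SucI[where f' = "\<lambda>x v. v"] Ck_on_const simp del: Ck_on.simps(2))

lemma Ck_on_add:
  assumes "open S" "Ck_on k f S" "Ck_on k g S"
  shows "Ck_on k (\<lambda>x. f x + g x) S"
  using assms(2,3)
proof (induction k arbitrary: f g)
  case 0
  then show ?case by (auto intro: continuous_intros)
next
  case (Suc k)
  note d = has_derivative_add[OF Ck_on_Suc_has_derivative[OF Suc.prems(1)]
      Ck_on_Suc_has_derivative[OF Suc.prems(2)]]
  show ?case
    using Suc.prems
    by (intro Ck_on_SucI[OF \<open>open S\<close> d] Suc.IH) auto
qed

lemma Ck_on_sum:
  assumes "open S" "\<And>i. i \<in> I \<Longrightarrow> Ck_on k (f i) S"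
  shows "Ck_on k (\<lambda>x. \<Sum>i\<in>I. f i x) S"
  using assms by (induction I rule: infinite_finite_induct) (auto intro: Ck_on_add Ck_on_const)

lemma Ck_on_bilinear:
  assumes "bounded_bilinear B" "open S" "Ck_on k f S" "Ck_on k g S"
  shows "Ck_on k (\<lambda>x. B (f x) (g x)) S"
  using assms(3,4)
proof (induction k arbitrary: f g)
  case 0
  then show ?case
    using assms(1) by (auto intro: bounded_bilinear.continuous_on)
next
  case (Suc k)
  note d = bounded_bilinear.FDERIV[OF assms(1) Ck_on_Suc_has_derivative[OF Suc.prems(1)]
      Ck_on_Suc_has_derivative[OF Suc.prems(2)]]
  show ?case
    using Suc.prems Ck_on_Suc_imp[OF Suc.prems(1)] Ck_on_Suc_imp[OF Suc.prems(2)]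
    by (intro Ck_on_SucI[OF \<open>open S\<close> d] Ck_on_add Suc.IH assms(2)) auto
qed

lemma Ck_on_inverse:
  fixes f :: "'a::real_normed_vector \<Rightarrow> real"
  assumes "open S" "Ck_on k f S" "\<And>x. x \<in> S \<Longrightarrow> f x \<noteq> 0"
  shows "Ck_on k (\<lambda>x. inverse (f x)) S"
  using assms(2,3)
proof (induction k)
  case 0
  then show ?case by (auto intro!: continuous_intros)
next
  case (Suc k)
  have IH: "Ck_on k (\<lambda>x. inverse (f x)) S"
    using Suc Ck_on_Suc_imp by blast
  have d: "((\<lambda>x. inverse (f x)) has_derivative
      (\<lambda>v. - (inverse (f x) * frechet_derivative f (at x) v * inverse (f x)))) (at x)" if "x \<in> S" for x
    using Deriv.has_derivative_inverse[OF Suc.prems(2)[OF that] Ck_on_Suc_has_derivative[OF Suc.prems(1) that]]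
    by simp
  show ?case
    using Suc.prems(1) IH \<open>open S\<close>
    by (intro Ck_on_SucI[OF \<open>open S\<close> d] Ck_on_linear[OF bounded_linear_minus[OF bounded_linear_ident]]
        Ck_on_bilinear[OF bounded_bilinear_mult]) auto
qed

lemma linear_euclidean_expansion:
  assumes "linear L"
  shows "L v = (\<Sum>b\<in>Basis. (v \<bullet> b) *\<^sub>R L b)"
proof -
  have "L v = L (\<Sum>b\<in>Basis. (v \<bullet> b) *\<^sub>R b)"
    by (simp add: euclidean_representation)
  then show ?thesis
    by (simp only: linear_sum[OF assms] linear_scale[OF assms])
qed

text \<open>The chain rule yields the composite of a derivative of \<open>q\<close> with \<open>p\<close>, applied to a vector
  that depends on the base point. Expanding that vector in the standard basis turns the derivative
  into a sum of products of functions to which the induction hypothesis applies, with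
  the codomain of \<open>q\<close> unchanged.\<close>

lemma Ck_on_compose:
  fixes q :: "'b::euclidean_space \<Rightarrow> 'c::real_normed_vector" and p :: "'a::real_normed_vector \<Rightarrow> 'b"
  assumes "open U" "open V" "p ` U \<subseteq> V" "Ck_on k p U" "Ck_on k q V"
  shows "Ck_on k (\<lambda>x. q (p x)) U"
  using assms(4,5)
proof (induction k arbitrary: q)
  case 0
  then show ?case
    using assms(3) by (auto intro: continuous_on_compose2)
next
  case (Suc k)
  let ?D = "\<lambda>x v. \<Sum>b\<in>Basis. (frechet_derivative p (at x) v \<bullet> b) *\<^sub>R frechet_derivative q (at (p x)) b"
  have d: "((\<lambda>x. q (p x)) has_derivative ?D x) (at x)" if "x \<in> U" for x
  proof -
    have p: "(p has_derivative frechet_derivative p (at x)) (at x)"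
      using Ck_on_Suc_has_derivative Suc.prems(1) that .
    have q: "(q has_derivative frechet_derivative q (at (p x))) (at (p x))"
      using Ck_on_Suc_has_derivative Suc.prems(2) assms(3) that by blast
    have "((\<lambda>x. q (p x)) has_derivative
        (\<lambda>v. frechet_derivative q (at (p x)) (frechet_derivative p (at x) v))) (at x)"
      using diff_chain_at[OF p q] by (simp add: o_def)
    moreover have "linear (frechet_derivative q (at (p x)))"
      using has_derivative_linear[OF q] .
    ultimately show ?thesis
      using linear_euclidean_expansion by (metis (no_types, lifting) ext)
  qed
  have "Ck_on k (\<lambda>x. ?D x v) U" for v
  proof (intro Ck_on_sum Ck_on_bilinear[OF bounded_bilinear_scaleR] \<open>open U\<close>)
    fix b :: 'b
    show "Ck_on k (\<lambda>x. frechet_derivative p (at x) v \<bullet> b) U"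
      using Suc.prems(1) by (intro Ck_on_linear[OF bounded_linear_inner_left] \<open>open U\<close>) auto
    show "Ck_on k (\<lambda>x. frechet_derivative q (at (p x)) b) U"
      using Suc.prems Ck_on_Suc_imp[OF Suc.prems(1)] by (intro Suc.IH) auto
  qed
  with d show ?case
    by (intro Ck_on_SucI[OF \<open>open U\<close>])
qed

lemma smooth_on_open_has_derivative:
  assumes "smooth_on_open f S" "x \<in> S"
  shows "(f has_derivative frechet_derivative f (at x)) (at x)"
  using assms Ck_on_Suc_has_derivative unfolding smooth_on_open_def by blast

lemma smooth_on_open_frechet_derivative:
  assumes "smooth_on_open f S"
  shows "smooth_on_open (\<lambda>x. frechet_derivative f (at x) v) S"
  using assms unfolding smooth_on_open_def by (metis Ck_on.simps(2))

lemma smooth_on_open_subset: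
  assumes "smooth_on_open f S" "open T" "T \<subseteq> S"
  shows "smooth_on_open f T"
  using assms Ck_on_subset unfolding smooth_on_open_def by blast

lemma smooth_on_open_linear:
  assumes "bounded_linear L" "smooth_on_open f S"
  shows "smooth_on_open (\<lambda>x. L (f x)) S"
  using assms Ck_on_linear unfolding smooth_on_open_def by blast

lemma smooth_on_open_compose:
  assumes "smooth_on_open p U" "smooth_on_open q V" "p ` U \<subseteq> V"
  shows "smooth_on_open (\<lambda>x. q (p x)) U"
  using assms Ck_on_compose unfolding smooth_on_open_def by blast

section \<open>Symmetry of second derivatives\<close>

text \<open>The second difference of \<open>f\<close> over the parallelogram with sides \<open>t v\<close> and \<open>t w\<close> is,
  up to \<open>o(t\<^sup>2)\<close>, \<open>t\<^sup>2\<close> times the derivative in direction \<open>w\<close> of the directional derivative along \<open>v\<close>.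
  The mean value inequality is applied to the difference of \<open>f\<close> along the two sides parallel
  to \<open>v\<close>. As the second difference is symmetric in \<open>v\<close> and \<open>w\<close>, mixed derivatives commute.\<close>

lemma second_difference_bound:
  fixes f :: "'a::real_normed_vector \<Rightarrow> 'b::real_normed_vector"
  assumes "open U" "x \<in> U"
    and f: "\<And>y. y \<in> U \<Longrightarrow> (f has_derivative f' y) (at y)"
    and A: "((\<lambda>y. f' y v) has_derivative A) (at x)"
    and "e > 0"
  shows "eventually (\<lambda>t. norm (f (x + t *\<^sub>R v + t *\<^sub>R w) - f (x + t *\<^sub>R v) - f (x + t *\<^sub>R w) + f x
            - t\<^sup>2 *\<^sub>R A w) \<le> e * t\<^sup>2) (at_right 0)"
proof -
  \<comment> \<open>\<open>t K\<close> bounds the sum of the distances to \<open>x\<close> of the two points at which \<open>f'\<close> is linearized below.\<close>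
  define K where "K = 2 * norm v + norm w + 1"
  have K: "K > 0" "2 * norm v + norm w \<le> K"
    unfolding K_def by (auto intro: add_nonneg_pos)
  obtain d where d: "d > 0" "\<And>y. norm (y - x) < d \<Longrightarrow>
      norm (f' y v - f' x v - A (y - x)) \<le> (e / K) * norm (y - x)"
    using A \<open>e > 0\<close> K(1) unfolding has_derivative_at_alt by (metis divide_pos_pos)
  obtain r where r: "r > 0" "ball x r \<subseteq> U"
    using \<open>open U\<close> \<open>x \<in> U\<close> openE by blast
  interpret A: bounded_linear A
    using A by (rule has_derivative_bounded_linear)
  have main: "norm (f (x + t *\<^sub>R v + t *\<^sub>R w) - f (x + t *\<^sub>R v) - f (x + t *\<^sub>R w) + f x
            - t\<^sup>2 *\<^sub>R A w) \<le> e * t\<^sup>2" if t: "0 < t" "t < min d r / K" for t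
  proof -
    have tK: "t * K < d" "t * K < r"
      using t K(1) by (auto simp: field_simps)
    \<comment> \<open>\<open>h\<close> moves the side \<open>t w\<close> along \<open>v\<close>; \<open>h 1 - h 0\<close> is the quantity to be bounded.\<close>
    define h where "h = (\<lambda>s. f (x + (s * t) *\<^sub>R v + t *\<^sub>R w) - f (x + (s * t) *\<^sub>R v) - (s * t\<^sup>2) *\<^sub>R A w)"
    define h' where "h' = (\<lambda>s. t *\<^sub>R f' (x + (s * t) *\<^sub>R v + t *\<^sub>R w) v - t *\<^sub>R f' (x + (s * t) *\<^sub>R v) v
        - t\<^sup>2 *\<^sub>R A w)"
    have n2: "norm ((s * t) *\<^sub>R v) \<le> t * norm v" if "s \<in> {0..1}" for s
    proof -
      have "s * t \<le> t"
        using that t(1) by (simp add: mult_left_le_one_le)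
      then show ?thesis
        using that t(1) by (simp add: mult_right_mono)
    qed
    have n1: "norm ((s * t) *\<^sub>R v + t *\<^sub>R w) \<le> t * (norm v + norm w)" if "s \<in> {0..1}" for s
      using norm_triangle_mono[OF n2[OF that], of "t *\<^sub>R w" "t * norm w"] t(1)
      by (simp add: distrib_left)
    have lt: "t * (norm v + norm w) < d" "t * (norm v + norm w) < r" "t * norm v < d" "t * norm v < r"
    proof -
      have "t * (norm v + norm w) \<le> t * K" "t * norm v \<le> t * K"
        using t(1) unfolding K_def by (auto intro!: mult_left_mono)
      then show "t * (norm v + norm w) < d" "t * (norm v + norm w) < r" "t * norm v < d" "t * norm v < r"
        using tK by linarith+
    qed
    have U: "x + (s * t) *\<^sub>R v + t *\<^sub>R w \<in> U" "x + (s * t) *\<^sub>R v \<in> U" if "s \<in> {0..1}" for s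
    proof -
      have "dist (x + (s * t) *\<^sub>R v + t *\<^sub>R w) x = norm ((s * t) *\<^sub>R v + t *\<^sub>R w)"
        unfolding dist_norm by (simp add: add.assoc)
      moreover have "dist (x + (s * t) *\<^sub>R v) x = norm ((s * t) *\<^sub>R v)"
        by (simp add: dist_norm)
      ultimately show "x + (s * t) *\<^sub>R v + t *\<^sub>R w \<in> U" "x + (s * t) *\<^sub>R v \<in> U"
        using n1[OF that] n2[OF that] lt r(2) by (auto simp: subset_iff dist_commute)
    qed
    have lin: "f' y (c *\<^sub>R v) = c *\<^sub>R f' y v" if "y \<in> U" for y c
      using has_derivative_linear[OF f[OF that]] by (rule linear_scale)
    have h: "(h has_derivative (\<lambda>a. a *\<^sub>R h' s)) (at s within {0..1})" if "s \<in> {0..1}" for s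
    proof -
      have i1: "((\<lambda>s. x + (s * t) *\<^sub>R v + t *\<^sub>R w) has_derivative (\<lambda>a. (a * t) *\<^sub>R v)) (at s within {0..1})"
        and i2: "((\<lambda>s. x + (s * t) *\<^sub>R v) has_derivative (\<lambda>a. (a * t) *\<^sub>R v)) (at s within {0..1})"
        by (auto intro!: derivative_eq_intros)
      have 1: "((\<lambda>s. f (x + (s * t) *\<^sub>R v + t *\<^sub>R w)) has_derivative
          (\<lambda>a. f' (x + (s * t) *\<^sub>R v + t *\<^sub>R w) ((a * t) *\<^sub>R v))) (at s within {0..1})"
        by (rule has_derivative_compose[OF i1 f[OF U(1)[OF that]]])
      have 2: "((\<lambda>s. f (x + (s * t) *\<^sub>R v)) has_derivative
          (\<lambda>a. f' (x + (s * t) *\<^sub>R v) ((a * t) *\<^sub>R v))) (at s within {0..1})"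
        by (rule has_derivative_compose[OF i2 f[OF U(2)[OF that]]])
      have 3: "((\<lambda>s. (s * t\<^sup>2) *\<^sub>R A w) has_derivative (\<lambda>a. (a * t\<^sup>2) *\<^sub>R A w)) (at s within {0..1})"
        by (auto intro!: derivative_eq_intros)
      show ?thesis
        unfolding h_def
        by (rule has_derivative_eq_rhs[OF has_derivative_diff[OF has_derivative_diff[OF 1 2] 3]])
          (simp only: lin[OF U(1)[OF that]] lin[OF U(2)[OF that]] h'_def scaleR_diff_right scaleR_scaleR)
    qed
    have bound: "norm (h' s) \<le> e * t\<^sup>2" if s: "s \<in> {0..1}" for s
    proof -
      let ?y = "x + (s * t) *\<^sub>R v + t *\<^sub>R w" and ?z = "x + (s * t) *\<^sub>R v"
      have eK: "e / K \<ge> 0"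
        using \<open>e > 0\<close> K(1) by simp
      have dy: "?y - x = (s * t) *\<^sub>R v + t *\<^sub>R w" and dz: "?z - x = (s * t) *\<^sub>R v"
        by simp_all
      have y: "norm (f' ?y v - f' x v - A (?y - x)) \<le> (e / K) * (t * (norm v + norm w))"
        using d(2)[of ?y] n1[OF s] lt(1) eK unfolding dy
        by (smt (verit) mult_left_mono)
      have z: "norm (f' ?z v - f' x v - A (?z - x)) \<le> (e / K) * (t * norm v)"
        using d(2)[of ?z] n2[OF s] lt(3) eK unfolding dz
        by (smt (verit) mult_left_mono)
      have "h' s = t *\<^sub>R ((f' ?y v - f' x v - A (?y - x)) - (f' ?z v - f' x v - A (?z - x)))"
        unfolding h'_def dy dz
        by (simp add: A.add A.scaleR algebra_simps power2_eq_square)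
      then have "norm (h' s) \<le> t * ((e / K) * (t * (norm v + norm w)) + (e / K) * (t * norm v))"
        using t(1) norm_triangle_le_diff[of "f' ?y v - f' x v - A (?y - x)"
            "f' ?z v - f' x v - A (?z - x)"] y z by simp
      also have "\<dots> = t\<^sup>2 * (e / K) * (2 * norm v + norm w)"
        by (simp add: algebra_simps power2_eq_square)
      also have "\<dots> \<le> t\<^sup>2 * (e / K) * K"
        using K \<open>e > 0\<close> by (intro mult_left_mono) auto
      finally show ?thesis
        using K(1) by (simp add: mult.commute)
    qed
    have "norm (h 1 - h 0) \<le> e * t\<^sup>2 * norm (1 - 0 :: real)"
    proof (rule differentiable_bound[of "{0..1}" h "\<lambda>s a. a *\<^sub>R h' s"])
      show "onorm (\<lambda>a. a *\<^sub>R h' s) \<le> e * t\<^sup>2" if "s \<in> {0..1}" for s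
        using bound[OF that] \<open>e > 0\<close>
        by (intro onorm_le) (auto simp: mult.commute mult_left_mono)
    qed (use h in auto)
    moreover have "h 1 - h 0 = f (x + t *\<^sub>R v + t *\<^sub>R w) - f (x + t *\<^sub>R v) - f (x + t *\<^sub>R w) + f x
            - t\<^sup>2 *\<^sub>R A w"
      by (simp add: h_def)
    ultimately show ?thesis
      by simp
  qed
  show ?thesis
    unfolding eventually_at_right_field
  proof (intro exI conjI allI impI)
    show "0 < min d r / K"
      using d(1) r(1) K(1) by simp
  qed (rule main)
qed

lemma second_derivative_symmetric:
  fixes f :: "'a::real_normed_vector \<Rightarrow> 'b::real_normed_vector"
  assumes "open U" "x \<in> U"
    and f: "\<And>y. y \<in> U \<Longrightarrow> (f has_derivative f' y) (at y)"
    and A: "((\<lambda>y. f' y v) has_derivative A) (at x)"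
    and B: "((\<lambda>y. f' y w) has_derivative B) (at x)"
  shows "A w = B v"
proof -
  have "norm (A w - B v) \<le> e" if "e > 0" for e
  proof -
    let ?D = "\<lambda>t. f (x + t *\<^sub>R v + t *\<^sub>R w) - f (x + t *\<^sub>R v) - f (x + t *\<^sub>R w) + f x"
    have evA: "eventually (\<lambda>t. norm (?D t - t\<^sup>2 *\<^sub>R A w) \<le> e / 2 * t\<^sup>2) (at_right 0)"
      using f A half_gt_zero[OF that] by (rule second_difference_bound[OF assms(1,2)])
    have "eventually (\<lambda>t. norm (f (x + t *\<^sub>R w + t *\<^sub>R v) - f (x + t *\<^sub>R w) - f (x + t *\<^sub>R v) + f x
        - t\<^sup>2 *\<^sub>R B v) \<le> e / 2 * t\<^sup>2) (at_right 0)"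
      using f B half_gt_zero[OF that] by (rule second_difference_bound[OF assms(1,2)])
    moreover have swap: "f (x + t *\<^sub>R w + t *\<^sub>R v) - f (x + t *\<^sub>R w) - f (x + t *\<^sub>R v) + f x = ?D t" for t
      unfolding add.assoc add.commute[of "t *\<^sub>R w" "t *\<^sub>R v"]
      by (rule arg_cong[where f = "\<lambda>z. z + f x", OF cancel_ab_semigroup_add_class.diff_right_commute])
    ultimately have evB: "eventually (\<lambda>t. norm (?D t - t\<^sup>2 *\<^sub>R B v) \<le> e / 2 * t\<^sup>2) (at_right 0)"
      by (simp only:)
    have "eventually (\<lambda>t. norm (A w - B v) \<le> e) (at_right (0::real))"
      using evA evB eventually_at_right_less[of 0]
    proof eventually_elim
      case (elim t)
      have "norm (t\<^sup>2 *\<^sub>R (A w - B v)) = norm ((?D t - t\<^sup>2 *\<^sub>R B v) - (?D t - t\<^sup>2 *\<^sub>R A w))"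
        by (simp add: algebra_simps)
      also have "\<dots> \<le> (e / 2) * t\<^sup>2 + (e / 2) * t\<^sup>2"
        by (rule order_trans[OF norm_triangle_ineq4 add_mono[OF elim(2,1)]])
      also have "\<dots> = t\<^sup>2 * e"
        by simp
      finally have "t\<^sup>2 * norm (A w - B v) \<le> t\<^sup>2 * e"
        by (simp only: norm_scaleR abs_power2)
      then show ?case
        using elim(3) by (simp only: mult_le_cancel_left_pos zero_less_power)
    qed
    then show ?thesis
      by (simp only: eventually_const[OF trivial_limit_at_right_real])
  qed
  then have "norm (A w - B v) \<le> 0 + e" if "e > 0" for e
    using that by simp
  then have "norm (A w - B v) \<le> 0"
    by (rule field_le_epsilon)
  then show ?thesis
    by simp
qed

text \<open>Differentiating \<open>D\<^sub>Y F\<close> along a field \<open>Y\<close> gives a first-order term, in which \<open>Y\<close> is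
  differentiated, and a second-order term that is symmetric in the two directions. Derivatives are
  taken within a set \<open>S\<close> because \<open>Y\<close> will be known on a submanifold only.\<close>

lemma iterated_directional_derivative:
  fixes F :: "'a::euclidean_space \<Rightarrow> 'b::real_normed_vector"
  assumes F: "smooth_on_open F U" and "x \<in> U"
  obtains D where "\<And>v w. D v w = D w v"
    and "\<And>Y Y' S. (Y has_derivative Y') (at x within S) \<Longrightarrow>
      ((\<lambda>y. frechet_derivative F (at y) (Y y)) has_derivative
        (\<lambda>h. frechet_derivative F (at x) (Y' h) + D h (Y x))) (at x within S)"
proof -
  \<comment> \<open>\<open>G v\<close> is the derivative at \<open>x\<close> of the directional derivative of \<open>F\<close> along the constant \<open>v\<close>.\<close>
  define G where "G = (\<lambda>v. frechet_derivative (\<lambda>y. frechet_derivative F (at y) v) (at x))"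
  define D where "D = (\<lambda>h v. \<Sum>b\<in>Basis. (v \<bullet> b) *\<^sub>R G b h)"
  have "open U"
    using F by (simp add: smooth_on_open_def)
  have lin: "linear (frechet_derivative F (at y))" if "y \<in> U" for y
    using smooth_on_open_has_derivative[OF F that] by (rule has_derivative_linear)
  have G: "((\<lambda>y. frechet_derivative F (at y) b) has_derivative G b) (at x within S)" for b S
    unfolding G_def
    using smooth_on_open_has_derivative[OF smooth_on_open_frechet_derivative[OF F] \<open>x \<in> U\<close>]
    by (rule has_derivative_at_withinI)
  have D: "((\<lambda>y. frechet_derivative F (at y) (Y y)) has_derivative
        (\<lambda>h. frechet_derivative F (at x) (Y' h) + D h (Y x))) (at x within S)"
    if Y: "(Y has_derivative Y') (at x within S)" for Y Y' S
  proof -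
    have Yb: "((\<lambda>y. Y y \<bullet> b) has_derivative (\<lambda>h. Y' h \<bullet> b)) (at x within S)" for b
      using Y by (rule has_derivative_inner_left)
    have "((\<lambda>y. \<Sum>b\<in>Basis. (Y y \<bullet> b) *\<^sub>R frechet_derivative F (at y) b) has_derivative
        (\<lambda>h. \<Sum>b\<in>Basis. (Y x \<bullet> b) *\<^sub>R G b h + (Y' h \<bullet> b) *\<^sub>R frechet_derivative F (at x) b))
        (at x within S)"
      by (intro has_derivative_sum has_derivative_scaleR Yb G)
    moreover have "(\<lambda>h. \<Sum>b\<in>Basis. (Y x \<bullet> b) *\<^sub>R G b h + (Y' h \<bullet> b) *\<^sub>R frechet_derivative F (at x) b)
        = (\<lambda>h. frechet_derivative F (at x) (Y' h) + D h (Y x))"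
      by (simp add: D_def sum.distrib add.commute flip: linear_euclidean_expansion[OF lin[OF \<open>x \<in> U\<close>]])
    ultimately have "((\<lambda>y. \<Sum>b\<in>Basis. (Y y \<bullet> b) *\<^sub>R frechet_derivative F (at y) b) has_derivative
        (\<lambda>h. frechet_derivative F (at x) (Y' h) + D h (Y x))) (at x within S)"
      by (simp only:)
    then show ?thesis
      using \<open>open U\<close> \<open>x \<in> U\<close> linear_euclidean_expansion[OF lin, symmetric]
      by (rule has_derivative_transform_within_open)
  qed
  have D': "((\<lambda>y. frechet_derivative F (at y) v) has_derivative (\<lambda>h. D h v)) (at x)" for v
    using D[OF has_derivative_const, of v UNIV] lin[OF \<open>x \<in> U\<close>] by (simp add: linear_0)
  have "D v w = D w v" for v w
    using second_derivative_symmetric[OF \<open>open U\<close> \<open>x \<in> U\<close> smooth_on_open_has_derivative[OF F] D' D'] .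
  then show thesis
    using D by (rule that)
qed

section \<open>Smooth functions on a subset\<close>

lemma smooth_on_mfdE:
  assumes "smooth_on_mfd M f" "x \<in> M"
  obtains U F where "open U" "x \<in> U" "smooth_on_open F U" "\<And>y. y \<in> U \<Longrightarrow> y \<in> M \<Longrightarrow> F y = f y"
proof -
  obtain U F where U: "x \<in> U" "smooth_on_open F U" "\<forall>y\<in>U \<inter> M. F y = f y"
    using bspec[OF assms(1)[unfolded smooth_on_mfd_def] assms(2)] by (elim exE conjE)
  moreover have "open U"
    using U(2) by (simp add: smooth_on_open_def)
  ultimately show thesis
    by (intro that[of U F]) auto
qed

lemma smooth_on_mfdI:
  assumes "\<And>x. x \<in> M \<Longrightarrow>
    \<exists>U F. x \<in> U \<and> smooth_on_open F U \<and> (\<forall>y\<in>U \<inter> M. F y = f y)"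
  shows "smooth_on_mfd M f"
  unfolding smooth_on_mfd_def using assms by (rule ballI)

lemma smooth_on_open_imp_smooth_on_mfd:
  assumes "smooth_on_open f U"
  shows "smooth_on_mfd (U \<inter> M) f"
  by (rule smooth_on_mfdI, rule exI[of _ U], rule exI[of _ f]) (use assms in auto)

lemma smooth_on_mfd_local:
  assumes "\<And>x. x \<in> M \<Longrightarrow> \<exists>U. open U \<and> x \<in> U \<and> smooth_on_mfd (U \<inter> M) f"
  shows "smooth_on_mfd M f"
proof (rule smooth_on_mfdI)
  fix x assume "x \<in> M"
  then obtain U where U: "open U" "x \<in> U" "smooth_on_mfd (U \<inter> M) f"
    using assms by blast
  then obtain V F where V: "open V" "x \<in> V" "smooth_on_open F V" "\<And>y. y \<in> V \<Longrightarrow> y \<in> U \<inter> M \<Longrightarrow> F y = f y"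
    using smooth_on_mfdE[OF U(3) IntI[OF U(2) \<open>x \<in> M\<close>]] by metis
  have "smooth_on_open F (V \<inter> U)"
    using V(1,3) U(1) by (intro smooth_on_open_subset[OF V(3)]) auto
  then show "\<exists>U F. x \<in> U \<and> smooth_on_open F U \<and> (\<forall>y\<in>U \<inter> M. F y = f y)"
    using U V by (intro exI[of _ "V \<inter> U"] exI[of _ F]) auto
qed

lemma smooth_on_mfd_subset:
  assumes "smooth_on_mfd M f" "N \<subseteq> M"
  shows "smooth_on_mfd N f"
proof (rule smooth_on_mfdI)
  fix x assume "x \<in> N"
  then obtain U F where "open U" "x \<in> U" "smooth_on_open F U" "\<And>y. y \<in> U \<Longrightarrow> y \<in> M \<Longrightarrow> F y = f y"
    using smooth_on_mfdE[OF assms(1)] assms(2) by (metis subsetD)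
  then show "\<exists>U F. x \<in> U \<and> smooth_on_open F U \<and> (\<forall>y\<in>U \<inter> N. F y = f y)"
    using assms(2) by (intro exI[of _ U] exI[of _ F]) auto
qed

lemma smooth_on_mfd_cong:
  assumes "smooth_on_mfd M f" "\<And>x. x \<in> M \<Longrightarrow> f x = g x"
  shows "smooth_on_mfd M g"
proof (rule smooth_on_mfdI)
  fix x assume "x \<in> M"
  from assms(1) this obtain U F where U: "open U" "x \<in> U" "smooth_on_open F U" "\<And>y. y \<in> U \<Longrightarrow> y \<in> M \<Longrightarrow> F y = f y"
    by (rule smooth_on_mfdE) (rule that)
  show "\<exists>U F. x \<in> U \<and> smooth_on_open F U \<and> (\<forall>y\<in>U \<inter> M. F y = g y)"
    by (intro exI[of _ U] exI[of _ F]) (simp add: U assms(2))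
qed

lemma smooth_on_mfd_linear:
  assumes "bounded_linear L" "smooth_on_mfd M f"
  shows "smooth_on_mfd M (\<lambda>x. L (f x))"
proof (rule smooth_on_mfdI)
  fix x assume "x \<in> M"
  from assms(2) this obtain U F where U: "open U" "x \<in> U" "smooth_on_open F U" "\<And>y. y \<in> U \<Longrightarrow> y \<in> M \<Longrightarrow> F y = f y"
    by (rule smooth_on_mfdE) (rule that)
  show "\<exists>U F. x \<in> U \<and> smooth_on_open F U \<and> (\<forall>y\<in>U \<inter> M. F y = L (f y))"
    by (intro exI[of _ U] exI[of _ "\<lambda>y. L (F y)"]) (simp add: U smooth_on_open_linear[OF assms(1)])
qed

lemma smooth_on_mfd_const: "smooth_on_mfd M (\<lambda>x. c)"
  by (rule smooth_on_mfdI, rule exI[of _ UNIV], rule exI[of _ "\<lambda>x. c"])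
    (simp add: smooth_on_open_def Ck_on_const)

lemma smooth_on_mfd_ident: "smooth_on_mfd M (\<lambda>x. x)"
  by (rule smooth_on_mfdI, rule exI[of _ UNIV], rule exI[of _ "\<lambda>x. x"])
    (simp add: smooth_on_open_def Ck_on_ident)

lemma smooth_on_mfd_common_domain:
  assumes "smooth_on_mfd M f" "smooth_on_mfd M g" "x \<in> M"
  obtains U F G where "open U" "x \<in> U" "smooth_on_open F U" "smooth_on_open G U"
    "\<And>y. y \<in> U \<Longrightarrow> y \<in> M \<Longrightarrow> F y = f y" "\<And>y. y \<in> U \<Longrightarrow> y \<in> M \<Longrightarrow> G y = g y"
proof -
  from assms(1,3) obtain U F where U: "open U" "x \<in> U" "smooth_on_open F U" "\<And>y. y \<in> U \<Longrightarrow> y \<in> M \<Longrightarrow> F y = f y"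
    by (rule smooth_on_mfdE) (rule that)
  from assms(2,3) obtain V G where V: "open V" "x \<in> V" "smooth_on_open G V" "\<And>y. y \<in> V \<Longrightarrow> y \<in> M \<Longrightarrow> G y = g y"
    by (rule smooth_on_mfdE) (rule that)
  have "smooth_on_open F (U \<inter> V)" "smooth_on_open G (U \<inter> V)"
    by (rule smooth_on_open_subset[OF U(3)], use U(1) V(1) in auto)
      (rule smooth_on_open_subset[OF V(3)], use U(1) V(1) in auto)
  then show thesis
    using U V by (intro that[of "U \<inter> V" F G]) auto
qed

lemma smooth_on_mfd_bilinear:
  assumes "bounded_bilinear B" "smooth_on_mfd M f" "smooth_on_mfd M g"
  shows "smooth_on_mfd M (\<lambda>x. B (f x) (g x))"
proof (rule smooth_on_mfdI)
  fix x assume "x \<in> M"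
  from assms(2,3) this obtain U F G where U: "open U" "x \<in> U" "smooth_on_open F U" "smooth_on_open G U"
    "\<And>y. y \<in> U \<Longrightarrow> y \<in> M \<Longrightarrow> F y = f y" "\<And>y. y \<in> U \<Longrightarrow> y \<in> M \<Longrightarrow> G y = g y"
    by (rule smooth_on_mfd_common_domain) (rule that)
  have "smooth_on_open (\<lambda>y. B (F y) (G y)) U"
    using U(3,4) by (auto simp: smooth_on_open_def intro: Ck_on_bilinear[OF assms(1)])
  then show "\<exists>U H. x \<in> U \<and> smooth_on_open H U \<and> (\<forall>y\<in>U \<inter> M. H y = B (f y) (g y))"
    by (intro exI[of _ U] exI[of _ "\<lambda>y. B (F y) (G y)"]) (simp add: U)
qed

lemma smooth_on_mfd_add:
  assumes "smooth_on_mfd M f" "smooth_on_mfd M g"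
  shows "smooth_on_mfd M (\<lambda>x. f x + g x)"
proof (rule smooth_on_mfdI)
  fix x assume "x \<in> M"
  from assms this obtain U F G where U: "open U" "x \<in> U" "smooth_on_open F U" "smooth_on_open G U"
    "\<And>y. y \<in> U \<Longrightarrow> y \<in> M \<Longrightarrow> F y = f y" "\<And>y. y \<in> U \<Longrightarrow> y \<in> M \<Longrightarrow> G y = g y"
    by (rule smooth_on_mfd_common_domain) (rule that)
  have "smooth_on_open (\<lambda>y. F y + G y) U"
    using U(3,4) by (auto simp: smooth_on_open_def intro: Ck_on_add)
  then show "\<exists>U H. x \<in> U \<and> smooth_on_open H U \<and> (\<forall>y\<in>U \<inter> M. H y = f y + g y)"
    by (intro exI[of _ U] exI[of _ "\<lambda>y. F y + G y"]) (simp add: U)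
qed

lemma smooth_on_mfd_diff:
  assumes "smooth_on_mfd M f" "smooth_on_mfd M g"
  shows "smooth_on_mfd M (\<lambda>x. f x - g x)"
  using smooth_on_mfd_add[OF assms(1) smooth_on_mfd_linear[OF bounded_linear_minus[OF bounded_linear_ident] assms(2)]]
  by simp

text \<open>The local extension of \<open>f\<close> may vanish off \<open>M\<close>, but not near a point of \<open>M\<close>.\<close>

lemma smooth_on_mfd_inverse:
  fixes f :: "'a::euclidean_space \<Rightarrow> real"
  assumes "smooth_on_mfd M f" "\<And>x. x \<in> M \<Longrightarrow> f x \<noteq> 0"
  shows "smooth_on_mfd M (\<lambda>x. inverse (f x))"
proof (rule smooth_on_mfdI)
  fix x assume "x \<in> M"
  from assms(1) this obtain U F where U: "open U" "x \<in> U" "smooth_on_open F U" "\<And>y. y \<in> U \<Longrightarrow> y \<in> M \<Longrightarrow> F y = f y"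
    by (rule smooth_on_mfdE) (rule that)
  have "Ck_on 0 F U"
    using U(3) unfolding smooth_on_open_def by blast
  then have cont: "continuous_on U F"
    by simp
  define W where "W = U \<inter> F -` (- {0})"
  have "open W"
    unfolding W_def using cont U(1) by (intro continuous_open_preimage) auto
  have "Ck_on k (\<lambda>y. inverse (F y)) W" for k
    using U(3) Ck_on_subset[of k F U W] unfolding smooth_on_open_def
    by (intro Ck_on_inverse[OF \<open>open W\<close>]) (auto simp: W_def)
  then have "smooth_on_open (\<lambda>y. inverse (F y)) W"
    using \<open>open W\<close> by (simp add: smooth_on_open_def)
  moreover have "x \<in> W"
    using U assms(2)[OF \<open>x \<in> M\<close>] \<open>x \<in> M\<close> by (auto simp: W_def)
  ultimately show "\<exists>U H. x \<in> U \<and> smooth_on_open H U \<and> (\<forall>y\<in>U \<inter> M. H y = inverse (f y))"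
    using U(4) by (intro exI[of _ W] exI[of _ "\<lambda>y. inverse (F y)"]) (auto simp: W_def)
qed

lemma has_derivative_of_extension:
  assumes "(F has_derivative F') (at x within M)" "open U" "x \<in> U" "x \<in> M"
    and "\<And>y. y \<in> U \<Longrightarrow> y \<in> M \<Longrightarrow> F y = f y"
  shows "(f has_derivative F') (at x within M)"
proof -
  obtain d where "d > 0" "ball x d \<subseteq> U"
    using assms(2,3) openE by blast
  then show ?thesis
    using assms(5)
    by (intro has_derivative_transform_within[OF assms(1) _ assms(4)]) (auto simp: subset_iff dist_commute)
qed

lemma smooth_on_mfd_differentiable:
  assumes "smooth_on_mfd M f" "x \<in> M"
  shows "f differentiable (at x within M)"
proof -
  from assms obtain U F where U: "open U" "x \<in> U" "smooth_on_open F U" "\<And>y. y \<in> U \<Longrightarrow> y \<in> M \<Longrightarrow> F y = f y"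
    by (rule smooth_on_mfdE) (rule that)
  have "(F has_derivative frechet_derivative F (at x)) (at x within M)"
    using smooth_on_open_has_derivative[OF U(3,2)] by (rule has_derivative_at_withinI)
  then have "(f has_derivative frechet_derivative F (at x)) (at x within M)"
    using U(1,2) assms(2) U(4) by (rule has_derivative_of_extension)
  then show ?thesis
    by (rule differentiableI)
qed

section \<open>Tangent vectors and directional derivatives\<close>

text \<open>This links directional derivatives along \<open>M\<close> to derivatives within the set \<open>M\<close>, for which
  the usual rules of calculus are available. A derivative within \<open>M\<close> is not unique as a linear map;
  its values on tangent vectors are.\<close>

lemma has_derivative_along_curve:
  assumes "curve_through M x \<xi> c" "(f has_derivative f') (at x within M)"
  shows "((f \<circ> c) has_vector_derivative f' \<xi>) (at 0)"
proof -
  obtain e where e: "e > 0" "c ` {-e<..<e} \<subseteq> M" "c 0 = x" "(c has_vector_derivative \<xi>) (at 0)"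
    using assms(1) unfolding curve_through_def by blast
  have c: "(c has_derivative (\<lambda>t. t *\<^sub>R \<xi>)) (at 0 within {-e<..<e})"
    using e(4) unfolding has_vector_derivative_def by (rule has_derivative_at_withinI)
  have "(f has_derivative f') (at (c 0) within c ` {-e<..<e})"
    using assms(2) e(2,3) has_derivative_subset by blast
  then have "((f \<circ> c) has_derivative (f' \<circ> (\<lambda>t. t *\<^sub>R \<xi>))) (at 0 within {-e<..<e})"
    using c by (rule diff_chain_within[rotated])
  moreover have "at 0 within {-e<..<e} = at 0"
    using e(1) by (intro at_within_open) auto
  moreover have "f' (t *\<^sub>R \<xi>) = t *\<^sub>R f' \<xi>" for t
    using has_derivative_linear[OF assms(2)] by (rule linear_scale)
  ultimately show ?thesis
    by (simp add: has_vector_derivative_def o_def)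
qed

lemma dir_deriv_eq:
  assumes "(f has_derivative f') (at x within M)" "\<xi> \<in> tangent_space M x"
  shows "dir_deriv M f x \<xi> = f' \<xi>"
  unfolding dir_deriv_def
proof (rule the_equality)
  show "\<forall>c. curve_through M x \<xi> c \<longrightarrow> ((f \<circ> c) has_vector_derivative f' \<xi>) (at 0)"
    using has_derivative_along_curve[OF _ assms(1)] by blast
  obtain c where "curve_through M x \<xi> c"
    using assms(2) unfolding tangent_space_def by blast
  then show "d = f' \<xi>"
    if "\<forall>c. curve_through M x \<xi> c \<longrightarrow> ((f \<circ> c) has_vector_derivative d) (at 0)" for d
    using that has_derivative_along_curve[OF _ assms(1)] vector_derivative_unique_at by blast
qed

lemma has_vector_derivative_curve_cong:
  assumes "curve_through M x \<xi> c" and "\<And>y. y \<in> M \<Longrightarrow> f y = g y"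
    and "((f \<circ> c) has_vector_derivative d) (at 0)"
  shows "((g \<circ> c) has_vector_derivative d) (at 0)"
proof -
  obtain e where e: "e > 0" "c ` {-e<..<e} \<subseteq> M"
    using assms(1) unfolding curve_through_def by blast
  then have "f (c t) = g (c t)" if "t \<in> {-e<..<e}" for t
    using that assms(2) by blast
  with e(1) show ?thesis
    by (intro has_vector_derivative_transform_within_open[OF assms(3), of "{-e<..<e}"]) auto
qed

lemma dir_deriv_cong:
  assumes "\<And>y. y \<in> M \<Longrightarrow> f y = g y"
  shows "dir_deriv M f x \<xi> = dir_deriv M g x \<xi>"
proof -
  have "((f \<circ> c) has_vector_derivative d) (at 0) \<longleftrightarrow> ((g \<circ> c) has_vector_derivative d) (at 0)"
    if "curve_through M x \<xi> c" for c d
    using has_vector_derivative_curve_cong[OF that, of f g d]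
      has_vector_derivative_curve_cong[OF that, of g f d] assms by auto
  then show ?thesis
    unfolding dir_deriv_def by (simp cong: imp_cong)
qed

lemma dir_deriv_add:
  assumes "f differentiable (at x within M)" "g differentiable (at x within M)"
    and "\<xi> \<in> tangent_space M x"
  shows "dir_deriv M (\<lambda>y. f y + g y) x \<xi> = dir_deriv M f x \<xi> + dir_deriv M g x \<xi>"
proof -
  obtain f' g' where d: "(f has_derivative f') (at x within M)" "(g has_derivative g') (at x within M)"
    using assms(1,2) unfolding differentiable_def by blast
  show ?thesis
    using dir_deriv_eq[OF has_derivative_add[OF d] assms(3)]
      dir_deriv_eq[OF d(1) assms(3)] dir_deriv_eq[OF d(2) assms(3)] by simp
qed

lemma dir_deriv_bilinear:
  assumes "bounded_bilinear B"
    and "f differentiable (at x within M)" "g differentiable (at x within M)"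
    and "\<xi> \<in> tangent_space M x"
  shows "dir_deriv M (\<lambda>y. B (f y) (g y)) x \<xi> = B (f x) (dir_deriv M g x \<xi>) + B (dir_deriv M f x \<xi>) (g x)"
proof -
  obtain f' g' where d: "(f has_derivative f') (at x within M)" "(g has_derivative g') (at x within M)"
    using assms(2,3) unfolding differentiable_def by blast
  show ?thesis
    using dir_deriv_eq[OF bounded_bilinear.FDERIV[OF assms(1) d] assms(4)]
      dir_deriv_eq[OF d(1) assms(4)] dir_deriv_eq[OF d(2) assms(4)] by simp
qed

lemma differentiable_bilinear:
  assumes "bounded_bilinear B"
    and "f differentiable (at x within M)" "g differentiable (at x within M)"
  shows "(\<lambda>y. B (f y) (g y)) differentiable (at x within M)"
  using bounded_bilinear.FDERIV[OF assms(1)] assms(2,3) unfolding differentiable_def by blast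

section \<open>Tangent spaces of embedded submanifolds\<close>

lemma subspace_is_kernel:
  fixes S :: "'e::euclidean_space set"
  assumes "subspace S"
  obtains N :: "'e \<Rightarrow> 'e" where "bounded_linear N" "\<And>u. N u = 0 \<longleftrightarrow> u \<in> S"
proof -
  obtain B where B: "B \<subseteq> S" "pairwise orthogonal B" "\<And>b. b \<in> B \<Longrightarrow> norm b = 1"
    "independent B" "span B = S"
    using orthonormal_basis_subspace[OF assms] by metis
  have "finite B"
    using B(4) by (rule independent_imp_finite)
  define N where "N = (\<lambda>u. u - (\<Sum>b\<in>B. (u \<bullet> b) *\<^sub>R b))"
  show thesis
  proof (rule that)
    show "bounded_linear N"
      unfolding N_def
      by (intro bounded_linear_sub bounded_linear_ident bounded_linear_sum
          bounded_linear_scaleR_const bounded_linear_inner_left)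
    show "N u = 0 \<longleftrightarrow> u \<in> S" for u
    proof
      assume "N u = 0"
      then have "u = (\<Sum>b\<in>B. (u \<bullet> b) *\<^sub>R b)"
        by (simp add: N_def)
      moreover have "(\<Sum>b\<in>B. (u \<bullet> b) *\<^sub>R b) \<in> S"
        using B(1) assms by (intro subspace_sum subspace_scale) auto
      ultimately show "u \<in> S"
        by metis
    next
      assume "u \<in> S"
      then show "N u = 0"
        using orthonormal_basis_expand[OF B(2,3) _ \<open>finite B\<close>, of u] B(5) by (simp add: N_def)
    qed
  qed
qed

lemma has_derivative_zero_on:
  fixes F :: "'a::euclidean_space \<Rightarrow> 'b::real_normed_vector"
  assumes "(F has_derivative F') (at x within M)" "open U" "x \<in> U" "x \<in> M"
    and "\<And>y. y \<in> U \<Longrightarrow> y \<in> M \<Longrightarrow> F y = 0" and "\<xi> \<in> tangent_space M x"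
  shows "F' \<xi> = 0"
proof -
  have "((\<lambda>y. 0 :: 'b) has_derivative F') (at x within M)"
    using assms(1-5) by (rule has_derivative_of_extension)
  then have "dir_deriv M (\<lambda>y. 0 :: 'b) x \<xi> = F' \<xi>"
    using assms(6) by (rule dir_deriv_eq)
  moreover have "dir_deriv M (\<lambda>y. 0 :: 'b) x \<xi> = 0"
    using has_derivative_const assms(6) by (rule dir_deriv_eq)
  ultimately show ?thesis
    by simp
qed

text \<open>A slice chart \<open>p\<close> with inverse \<open>q\<close>, onto a subspace \<open>S\<close>, presents the tangent spaces near \<open>x\<close> in
  two ways. Composing \<open>p\<close> with a linear map that has kernel \<open>S\<close> gives a local equation \<open>F\<close> of \<open>M\<close>,
  and tangent vectors are those annihilated by the derivative of \<open>F\<close>. Pushing a basis of \<open>S\<close> forward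
  by the derivative of \<open>q\<close> gives a smooth frame. The equation serves to recognize tangent
  vectors, the frame to build the tangent projection.\<close>

lemma embedded_submanifold_frame:
  fixes M :: "'e::euclidean_space set"
  assumes "embedded_submanifold M" "x \<in> M"
  obtains U and F :: "'e \<Rightarrow> 'e" and B :: "'e set" and V :: "'e \<Rightarrow> 'e \<Rightarrow> 'e"
  where "open U" "x \<in> U" "smooth_on_open F U"
    "\<And>y. y \<in> U \<Longrightarrow> y \<in> M \<Longrightarrow> tangent_space M y = {v. frechet_derivative F (at y) v = 0}"
    "finite B" "\<And>b. b \<in> B \<Longrightarrow> smooth_on_open (V b) U"
    "\<And>y. y \<in> U \<Longrightarrow> y \<in> M \<Longrightarrow> tangent_space M y = span ((\<lambda>b. V b y) ` B)"
    "\<And>y. y \<in> U \<Longrightarrow> y \<in> M \<Longrightarrow> inj_on (\<lambda>b. V b y) B"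
    "\<And>y. y \<in> U \<Longrightarrow> y \<in> M \<Longrightarrow> independent ((\<lambda>b. V b y) ` B)"
proof -
  obtain U W S and p q :: "'e \<Rightarrow> 'e" where chart: "x \<in> U" "smooth_on_open p U" "smooth_on_open q W"
    "homeomorphism U W p q" "subspace S" "p ` (U \<inter> M) = W \<inter> S"
    using assms unfolding embedded_submanifold_def by metis
  have "open U" "open W"
    using chart(2,3) by (simp_all add: smooth_on_open_def)
  have qp: "q (p y) = y" "p y \<in> W" if "y \<in> U" for y
    using chart(4) that unfolding homeomorphism_def by auto
  have pq: "p (q z) = z" "q z \<in> U" if "z \<in> W" for z
    using chart(4) that unfolding homeomorphism_def by auto
  let ?P = "\<lambda>y. frechet_derivative p (at y)" and ?Q = "\<lambda>z. frechet_derivative q (at z)"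
  note dp = smooth_on_open_has_derivative[OF chart(2)]
  note dq = smooth_on_open_has_derivative[OF chart(3)]
  have QP: "?Q (p y) (?P y v) = v" if "y \<in> U" for y v
  proof -
    have "((\<lambda>y. q (p y)) has_derivative (\<lambda>v. ?Q (p y) (?P y v))) (at y)"
      using dp[OF that] dq[OF qp(2)[OF that]] by (rule has_derivative_compose)
    moreover have "((\<lambda>y. q (p y)) has_derivative (\<lambda>v. v)) (at y)"
      using has_derivative_ident \<open>open U\<close> that qp(1)[symmetric] by (rule has_derivative_transform_within_open)
    ultimately have "(\<lambda>v. ?Q (p y) (?P y v)) = (\<lambda>v. v)"
      by (rule has_derivative_unique)
    then show ?thesis
      by (rule fun_cong)
  qed
  have PQ: "?P y (?Q (p y) u) = u" if "y \<in> U" for y u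
  proof -
    have "((\<lambda>z. p (q z)) has_derivative (\<lambda>u. ?P (q (p y)) (?Q (p y) u))) (at (p y))"
      by (rule has_derivative_compose[OF dq dp]) (simp_all add: qp that)
    moreover have "((\<lambda>z. p (q z)) has_derivative (\<lambda>u. u)) (at (p y))"
      using has_derivative_ident \<open>open W\<close> qp(2)[OF that] pq(1)[symmetric]
      by (rule has_derivative_transform_within_open)
    ultimately have "(\<lambda>u. ?P (q (p y)) (?Q (p y) u)) = (\<lambda>u. u)"
      by (rule has_derivative_unique)
    then show ?thesis
      using fun_cong[of "\<lambda>u. ?P (q (p y)) (?Q (p y) u)" "\<lambda>u. u" u] qp(1)[OF that] by simp
  qed
  obtain N :: "'e \<Rightarrow> 'e" where N: "bounded_linear N" "\<And>u. N u = 0 \<longleftrightarrow> u \<in> S"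
    using subspace_is_kernel[OF chart(5)] by metis
  define F where "F = (\<lambda>y. N (p y))"
  have F: "smooth_on_open F U"
    unfolding F_def using N(1) chart(2) by (rule smooth_on_open_linear)
  have F': "frechet_derivative F (at y) v = N (?P y v)" if "y \<in> U" for y v
  proof -
    have "(F has_derivative (\<lambda>v. N (?P y v))) (at y)"
      unfolding F_def using N(1) dp[OF that] by (rule bounded_linear.has_derivative)
    then show ?thesis
      using frechet_derivative_at by metis
  qed
  have F0: "F y = 0" if "y \<in> U" "y \<in> M" for y
    using chart(6) that N(2) unfolding F_def by blast
  have tangent: "v \<in> tangent_space M y \<longleftrightarrow> ?P y v \<in> S" if y: "y \<in> U" "y \<in> M" for y v
  proof
    assume v: "v \<in> tangent_space M y"
    have "(F has_derivative frechet_derivative F (at y)) (at y within M)"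
      using smooth_on_open_has_derivative[OF F y(1)] by (rule has_derivative_at_withinI)
    then have "frechet_derivative F (at y) v = 0"
      using \<open>open U\<close> y F0 v by (rule has_derivative_zero_on)
    then show "?P y v \<in> S"
      using F'[OF y(1)] N(2) by simp
  next
    assume u: "?P y v \<in> S"
    let ?u = "?P y v"
    \<comment> \<open>The image under \<open>q\<close> of a straight line in \<open>S\<close> is a curve in \<open>M\<close> with velocity \<open>v\<close>.\<close>
    define c where "c = (\<lambda>t::real. q (p y + t *\<^sub>R ?u))"
    have "open ((\<lambda>t::real. p y + t *\<^sub>R ?u) -` W)"
      by (intro open_vimage[OF \<open>open W\<close>] continuous_intros)
    moreover have "0 \<in> (\<lambda>t::real. p y + t *\<^sub>R ?u) -` W"
      using qp(2)[OF y(1)] by simp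
    ultimately obtain e where e: "e > 0" "ball 0 e \<subseteq> (\<lambda>t::real. p y + t *\<^sub>R ?u) -` W"
      by (rule openE)
    have inW: "p y + t *\<^sub>R ?u \<in> W" if "t \<in> {-e<..<e}" for t
      using e(2) that by (auto simp: subset_iff dist_real_def abs_less_iff)
    have py: "p y \<in> S"
      using chart(6) y by blast
    have "c t \<in> M" if t: "t \<in> {-e<..<e}" for t
    proof -
      have "p y + t *\<^sub>R ?u \<in> W \<inter> S"
        using inW[OF t] py u chart(5) by (auto intro: subspace_add subspace_scale)
      then obtain m where m: "m \<in> U" "m \<in> M" "p y + t *\<^sub>R ?u = p m"
        unfolding chart(6)[symmetric] by blast
      then show ?thesis
        unfolding c_def using qp(1) by simp
    qed
    then have "c ` {-e<..<e} \<subseteq> M"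
      by blast
    moreover have "smooth_on_open c {-e<..<e}"
      unfolding c_def
    proof (rule smooth_on_open_compose[OF _ chart(3)])
      show "smooth_on_open (\<lambda>t. p y + t *\<^sub>R ?u) {-e<..<e}"
        unfolding smooth_on_open_def
        by (auto intro!: Ck_on_add Ck_on_const Ck_on_linear[OF bounded_linear_scaleR_left] Ck_on_ident)
    qed (use inW in blast)
    moreover have "c 0 = y"
      using qp(1)[OF y(1)] by (simp add: c_def)
    moreover have "(c has_vector_derivative v) (at 0)"
    proof -
      have "((\<lambda>t::real. p y + t *\<^sub>R ?u) has_derivative (\<lambda>t. t *\<^sub>R ?u)) (at 0)"
        by (auto intro!: derivative_eq_intros)
      moreover have "(q has_derivative ?Q (p y)) (at (p y + 0 *\<^sub>R ?u))"
        using dq[OF qp(2)[OF y(1)]] by simp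
      ultimately have "(c has_derivative (\<lambda>t. ?Q (p y) (t *\<^sub>R ?u))) (at 0)"
        unfolding c_def by (rule has_derivative_compose)
      moreover have "?Q (p y) (t *\<^sub>R ?u) = t *\<^sub>R v" for t
        using linear_scale[OF has_derivative_linear[OF dq[OF qp(2)[OF y(1)]]]] QP[OF y(1)] by simp
      ultimately show ?thesis
        by (simp add: has_vector_derivative_def)
    qed
    ultimately show "v \<in> tangent_space M y"
      unfolding tangent_space_def curve_through_def using e(1) by blast
  qed
  obtain B where B: "B \<subseteq> S" "independent B" "span B = S"
    by (metis basis_exists span_eq span_minimal chart(5) span_eq_iff)
  have "finite B"
    using B(2) by (rule independent_imp_finite)
  define V where "V = (\<lambda>b y. ?Q (p y) b)"
  have V: "smooth_on_open (V b) U" for b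
    unfolding V_def
    using qp(2) by (intro smooth_on_open_compose[OF chart(2) smooth_on_open_frechet_derivative[OF chart(3)]]) auto
  have lin: "linear (?Q (p y))" if "y \<in> U" for y
    using has_derivative_linear[OF dq[OF qp(2)[OF that]]] .
  have inj: "inj_on (?Q (p y)) A" if "y \<in> U" for y A
    using PQ[OF that] by (rule inj_on_inverseI)
  show thesis
  proof (rule that[of U F B V])
    show "tangent_space M y = {v. frechet_derivative F (at y) v = 0}" if "y \<in> U" "y \<in> M" for y
      using tangent[OF that] F'[OF that(1)] N(2) by auto
    show "tangent_space M y = span ((\<lambda>b. V b y) ` B)" if y: "y \<in> U" "y \<in> M" for y
    proof -
      have "tangent_space M y = ?Q (p y) ` S"
      proof (intro set_eqI iffI)
        fix v assume "v \<in> tangent_space M y"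
        then show "v \<in> ?Q (p y) ` S"
          using tangent[OF y] QP[OF y(1)] by (metis image_eqI)
      qed (use tangent[OF y] PQ[OF y(1)] in auto)
      then show ?thesis
        unfolding V_def using linear_span_image[OF lin[OF y(1)], of B] B(3) by simp
    qed
    show "inj_on (\<lambda>b. V b y) B" if "y \<in> U" "y \<in> M" for y
      unfolding V_def using inj[OF that(1)] .
    show "independent ((\<lambda>b. V b y) ` B)" if "y \<in> U" "y \<in> M" for y
      unfolding V_def using linear_independent_injective_image[OF lin[OF that(1)] B(2) inj[OF that(1)]] .
  qed (use \<open>open U\<close> chart(1) F \<open>finite B\<close> V in auto)
qed

lemma subspace_tangent_space:
  assumes "embedded_submanifold M" "x \<in> M"
  shows "subspace (tangent_space M x)"
  using assms
proof (rule embedded_submanifold_frame)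
  fix U B and V :: "'a \<Rightarrow> 'a \<Rightarrow> 'a"
  assume "x \<in> U" "\<And>y. y \<in> U \<Longrightarrow> y \<in> M \<Longrightarrow> tangent_space M y = span ((\<lambda>b. V b y) ` B)"
  then have "tangent_space M x = span ((\<lambda>b. V b x) ` B)"
    using assms(2) by blast
  then show ?thesis
    by (simp only: subspace_span)
qed

section \<open>The tangent projection\<close>

text \<open>Gram-Schmidt with respect to the inner products \<open>g y\<close>, one frame vector at a time: if \<open>P\<close>
  projects onto the span of the earlier vectors and \<open>w\<close> is the component of the new vector orthogonal to
  them, then the projection onto the larger span adds to \<open>P\<close> the rank-one projection onto \<open>w\<close>. Independence
  keeps the denominator nonzero, so smoothness reduces to that of sums, products and
  reciprocals.\<close>

lemma smooth_orthogonal_projection: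
  fixes V :: "'i \<Rightarrow> 'e::euclidean_space \<Rightarrow> 'e" and g :: "'e \<Rightarrow> 'e \<Rightarrow>\<^sub>L 'e"
  assumes "finite B" "metric_operator N g"
    and "\<And>b. b \<in> B \<Longrightarrow> smooth_on_mfd N (V b)"
    and "\<And>y. y \<in> N \<Longrightarrow> inj_on (\<lambda>b. V b y) B"
    and "\<And>y. y \<in> N \<Longrightarrow> independent ((\<lambda>b. V b y) ` B)"
  shows "\<exists>P :: 'e \<Rightarrow> 'e \<Rightarrow>\<^sub>L 'e. smooth_on_mfd N P \<and>
    (\<forall>y\<in>N. \<forall>\<omega>. blinfun_apply (P y) \<omega> \<in> span ((\<lambda>b. V b y) ` B) \<and>
      (\<forall>\<zeta>\<in>span ((\<lambda>b. V b y) ` B). (\<omega> - blinfun_apply (P y) \<omega>) \<bullet> g y \<zeta> = 0))"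
  using assms(1,3,4,5)
proof (induction B rule: finite_induct)
  case empty
  show ?case
    by (rule exI[of _ "\<lambda>y. 0"]) (simp add: smooth_on_mfd_const)
next
  case (insert a B)
  have sym: "v \<bullet> g y w = g y v \<bullet> w" and pos: "v \<noteq> 0 \<Longrightarrow> 0 < v \<bullet> g y v"
    and smooth_g: "smooth_on_mfd N g" if "y \<in> N" for y v w
    using assms(2) that unfolding metric_operator_def by auto
  have ind: "independent ((\<lambda>b. V b y) ` B)" "V a y \<notin> span ((\<lambda>b. V b y) ` B)" if "y \<in> N" for y
    using insert.prems(2,3)[OF that] insert.hyps(2) by (auto simp: independent_insert)
  have "\<exists>P :: 'e \<Rightarrow> 'e \<Rightarrow>\<^sub>L 'e. smooth_on_mfd N P \<and>
    (\<forall>y\<in>N. \<forall>\<omega>. blinfun_apply (P y) \<omega> \<in> span ((\<lambda>b. V b y) ` B) \<and>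
      (\<forall>\<zeta>\<in>span ((\<lambda>b. V b y) ` B). (\<omega> - blinfun_apply (P y) \<omega>) \<bullet> g y \<zeta> = 0))"
    using insert.prems ind(1) by (intro insert.IH) (auto intro: inj_on_subset)
  then obtain P :: "'e \<Rightarrow> 'e \<Rightarrow>\<^sub>L 'e" where P: "smooth_on_mfd N P"
    "\<And>y \<omega>. y \<in> N \<Longrightarrow> blinfun_apply (P y) \<omega> \<in> span ((\<lambda>b. V b y) ` B)"
    "\<And>y \<omega> \<zeta>. y \<in> N \<Longrightarrow> \<zeta> \<in> span ((\<lambda>b. V b y) ` B) \<Longrightarrow> (\<omega> - blinfun_apply (P y) \<omega>) \<bullet> g y \<zeta> = 0"
    by (elim exE conjE) blast
  define w where "w = (\<lambda>y. V a y - P y (V a y))"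
  define c where "c = (\<lambda>y. w y \<bullet> g y (w y))"
  define R where "R = (\<lambda>y. blinfun_scaleR_left (w y) o\<^sub>L blinfun_inner_left (g y (w y)))"
  define P' where "P' = (\<lambda>y. P y + inverse (c y) *\<^sub>R R y)"
  have P'_apply: "P' y \<omega> = P y \<omega> + (\<omega> \<bullet> g y (w y) / c y) *\<^sub>R w y" for y \<omega>
    by (simp add: P'_def R_def blinfun.bilinear_simps divide_inverse mult.commute)
  have c: "c y \<noteq> 0" if "y \<in> N" for y
  proof -
    have "w y \<noteq> 0"
      using ind(2)[OF that] P(2)[OF that, of "V a y"] by (auto simp: w_def)
    then show ?thesis
      using pos[OF that] unfolding c_def by force
  qed
  have smooth: "smooth_on_mfd N P'"
  proof (cases "N = {}")
    case False
    then have g: "smooth_on_mfd N g"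
      using smooth_g by blast
    have w: "smooth_on_mfd N w"
      unfolding w_def using insert.prems(1)
      by (intro smooth_on_mfd_diff smooth_on_mfd_bilinear[OF bounded_bilinear_blinfun_apply P(1)]) auto
    have gw: "smooth_on_mfd N (\<lambda>y. g y (w y))"
      using g w by (rule smooth_on_mfd_bilinear[OF bounded_bilinear_blinfun_apply])
    have "smooth_on_mfd N c"
      unfolding c_def using w gw by (rule smooth_on_mfd_bilinear[OF bounded_bilinear_inner])
    then have "smooth_on_mfd N (\<lambda>y. inverse (c y))"
      using c by (rule smooth_on_mfd_inverse)
    moreover have "smooth_on_mfd N R"
      unfolding R_def using w gw
      by (intro smooth_on_mfd_bilinear[OF bounded_bilinear_blinfun_compose]
          smooth_on_mfd_linear[OF bounded_linear_blinfun_scaleR_left]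
          smooth_on_mfd_linear[OF bounded_linear_blinfun_inner_left])
    ultimately show ?thesis
      unfolding P'_def
      by (intro smooth_on_mfd_add P(1) smooth_on_mfd_bilinear[OF bounded_bilinear_scaleR])
  qed (simp add: smooth_on_mfd_def)
  have mem: "P' y \<omega> \<in> span ((\<lambda>b. V b y) ` insert a B)"
    and orth: "\<zeta> \<in> span ((\<lambda>b. V b y) ` insert a B) \<Longrightarrow> (\<omega> - P' y \<omega>) \<bullet> g y \<zeta> = 0"
    if y: "y \<in> N" for y \<omega> \<zeta>
  proof -
    let ?S = "span ((\<lambda>b. V b y) ` B)" and ?S' = "span ((\<lambda>b. V b y) ` insert a B)"
    have sub: "?S \<subseteq> ?S'"
      by (intro span_mono) auto
    have "V a y \<in> ?S'"
      by (intro span_base) auto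
    then have "w y \<in> ?S'"
      unfolding w_def using P(2)[OF y, of "V a y"] sub by (intro span_diff) auto
    then show "P' y \<omega> \<in> ?S'"
      unfolding P'_apply using P(2)[OF y, of \<omega>] sub by (intro span_add span_scale) auto
    have w_orth: "w y \<bullet> g y z = 0" if "z \<in> ?S" for z
      unfolding w_def using P(3)[OF y that] .
    have on_B: "(\<omega> - P' y \<omega>) \<bullet> g y z = 0" if "z \<in> ?S" for z
      using P(3)[OF y that, of \<omega>] w_orth[OF that]
      by (simp add: P'_apply inner_diff_left inner_add_left)
    have "P y \<omega> \<bullet> g y (w y) = 0"
      using w_orth[OF P(2)[OF y, of \<omega>]] sym[OF y, of "P y \<omega>" "w y"] by (simp add: inner_commute)
    then have on_w: "(\<omega> - P' y \<omega>) \<bullet> g y (w y) = 0"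
      using c[OF y] unfolding P'_apply inner_diff_left inner_add_left inner_scaleR_left
      by (simp add: c_def)
    have "V a y = w y + P y (V a y)"
      by (simp add: w_def)
    then have on_a: "(\<omega> - P' y \<omega>) \<bullet> g y (V a y) = 0"
      using on_w on_B[OF P(2)[OF y, of "V a y"]]
      by (metis blinfun.add_right inner_add_right add_0)
    have "?S' \<subseteq> {z. (\<omega> - P' y \<omega>) \<bullet> g y z = 0}"
    proof (rule span_minimal)
      show "(\<lambda>b. V b y) ` insert a B \<subseteq> {z. (\<omega> - P' y \<omega>) \<bullet> g y z = 0}"
        using on_a on_B by (auto intro: span_base)
      show "subspace {z. (\<omega> - P' y \<omega>) \<bullet> g y z = 0}"
        by (auto simp: subspace_def blinfun.bilinear_simps inner_add_right)
    qed
    then show "(\<omega> - P' y \<omega>) \<bullet> g y \<zeta> = 0" if "\<zeta> \<in> ?S'"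
      using that by blast
  qed
  show ?case
    using smooth mem orth by (intro exI[of _ P']) blast
qed

lemma metric_operator_nondegenerate:
  assumes "metric_operator M g" "x \<in> M" "v \<bullet> g x v = 0"
  shows "v = 0"
  using assms unfolding metric_operator_def by (metis less_irrefl)

lemma metric_operator_subset:
  assumes "metric_operator M g" "N \<subseteq> M"
  shows "metric_operator N g"
  using assms smooth_on_mfd_subset[of M g N] unfolding metric_operator_def by auto

text \<open>The difference of two orthogonal projections onto the tangent space takes tangent values
  orthogonal to every tangent vector.\<close>

lemma tangent_proj_eqI:
  fixes P :: "'e::euclidean_space \<Rightarrow>\<^sub>L 'e"
  assumes "metric_operator M g" "y \<in> M" "subspace (tangent_space M y)"
    and "\<And>\<omega>. P \<omega> \<in> tangent_space M y"
    and "\<And>\<omega> \<zeta>. \<zeta> \<in> tangent_space M y \<Longrightarrow> (\<omega> - P \<omega>) \<bullet> g y \<zeta> = 0"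
  shows "tangent_proj M g y = P"
  unfolding tangent_proj_def
proof (rule the_equality)
  show "\<forall>\<omega>. P \<omega> \<in> tangent_space M y \<and> (\<forall>\<zeta>\<in>tangent_space M y. (\<omega> - P \<omega>) \<bullet> g y \<zeta> = 0)"
    using assms(4,5) by blast
  fix Q :: "'e \<Rightarrow>\<^sub>L 'e"
  assume Q: "\<forall>\<omega>. Q \<omega> \<in> tangent_space M y \<and> (\<forall>\<zeta>\<in>tangent_space M y. (\<omega> - Q \<omega>) \<bullet> g y \<zeta> = 0)"
  show "Q = P"
  proof (rule blinfun_eqI)
    fix \<omega>
    let ?d = "Q \<omega> - P \<omega>"
    have d: "?d \<in> tangent_space M y"
      using Q assms(3,4) by (auto intro: subspace_diff)
    have "?d \<bullet> g y ?d = (\<omega> - P \<omega>) \<bullet> g y ?d - (\<omega> - Q \<omega>) \<bullet> g y ?d"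
      by (simp only: inner_diff_left[symmetric]) simp
    also have "\<dots> = 0"
      using assms(5)[OF d] Q d by simp
    finally have "?d = 0"
      using metric_operator_nondegenerate[OF assms(1,2)] by blast
    then show "Q \<omega> = P \<omega>"
      by simp
  qed
qed

text \<open>Locally \<^const>\<open>tangent_proj\<close> is the projection built from a smooth frame, and smoothness is
  local.\<close>

lemma tangent_proj_facts:
  assumes "embedded_submanifold M" "metric_operator M g"
  shows smooth_tangent_proj: "smooth_on_mfd M (tangent_proj M g)"
    and tangent_proj_mem: "x \<in> M \<Longrightarrow> tangent_proj M g x \<omega> \<in> tangent_space M x"
    and tangent_proj_orthogonal: "x \<in> M \<Longrightarrow> \<zeta> \<in> tangent_space M x \<Longrightarrow>
      (\<omega> - tangent_proj M g x \<omega>) \<bullet> g x \<zeta> = 0"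
proof -
  have local: "\<exists>U P. open U \<and> z \<in> U \<and> smooth_on_mfd (U \<inter> M) P \<and> (\<forall>y\<in>U \<inter> M. tangent_proj M g y = P y \<and>
      (\<forall>\<omega>. blinfun_apply (P y) \<omega> \<in> tangent_space M y \<and> (\<forall>\<zeta>\<in>tangent_space M y. (\<omega> - blinfun_apply (P y) \<omega>) \<bullet> g y \<zeta> = 0)))"
    if "z \<in> M" for z
  proof -
    from assms(1) that show ?thesis
    proof (rule embedded_submanifold_frame)
      fix U B V
      assume U: "open U" "z \<in> U" "finite B" "\<And>b. b \<in> B \<Longrightarrow> smooth_on_open (V b) U"
        "\<And>y. y \<in> U \<Longrightarrow> y \<in> M \<Longrightarrow> tangent_space M y = span ((\<lambda>b. V b y) ` B)"
        "\<And>y. y \<in> U \<Longrightarrow> y \<in> M \<Longrightarrow> inj_on (\<lambda>b. V b y) B"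
        "\<And>y. y \<in> U \<Longrightarrow> y \<in> M \<Longrightarrow> independent ((\<lambda>b. V b y) ` B)"
      have "\<exists>P :: 'a \<Rightarrow> 'a \<Rightarrow>\<^sub>L 'a. smooth_on_mfd (U \<inter> M) P \<and>
        (\<forall>y\<in>U \<inter> M. \<forall>\<omega>. blinfun_apply (P y) \<omega> \<in> span ((\<lambda>b. V b y) ` B) \<and>
          (\<forall>\<zeta>\<in>span ((\<lambda>b. V b y) ` B). (\<omega> - blinfun_apply (P y) \<omega>) \<bullet> g y \<zeta> = 0))"
        by (rule smooth_orthogonal_projection[OF U(3) metric_operator_subset[OF assms(2)]])
          (use U in \<open>auto intro: smooth_on_open_imp_smooth_on_mfd\<close>)
      then obtain P :: "'a \<Rightarrow> 'a \<Rightarrow>\<^sub>L 'a" where P: "smooth_on_mfd (U \<inter> M) P"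
        "\<forall>y\<in>U \<inter> M. \<forall>\<omega>. blinfun_apply (P y) \<omega> \<in> tangent_space M y \<and>
          (\<forall>\<zeta>\<in>tangent_space M y. (\<omega> - blinfun_apply (P y) \<omega>) \<bullet> g y \<zeta> = 0)"
        using U(5) by auto
      have "tangent_proj M g y = P y" if "y \<in> U \<inter> M" for y
        using that P(2) subspace_tangent_space[OF assms(1)]
        by (intro tangent_proj_eqI[OF assms(2)]) auto
      then show ?thesis
        using U(1,2) P by (intro exI[of _ U] exI[of _ P]) auto
    qed
  qed
  show "smooth_on_mfd M (tangent_proj M g)"
  proof (rule smooth_on_mfd_local)
    fix z assume "z \<in> M"
    then obtain U P where U: "open U" "z \<in> U" "smooth_on_mfd (U \<inter> M) P"
      "\<forall>y\<in>U \<inter> M. tangent_proj M g y = P y"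
      using local by (metis (no_types, lifting))
    have "smooth_on_mfd (U \<inter> M) (tangent_proj M g)"
      by (rule smooth_on_mfd_cong[OF U(3)]) (use U(4) in simp)
    then show "\<exists>U. open U \<and> z \<in> U \<and> smooth_on_mfd (U \<inter> M) (tangent_proj M g)"
      using U(1,2) by blast
  qed
  show "tangent_proj M g x \<omega> \<in> tangent_space M x" if "x \<in> M"
    using local[OF that] that by (metis (no_types, lifting) IntI)
  show "(\<omega> - tangent_proj M g x \<omega>) \<bullet> g x \<zeta> = 0" if "x \<in> M" "\<zeta> \<in> tangent_space M x"
    using local[OF that(1)] that by (metis (no_types, lifting) IntI)
qed

lemma tangent_proj_tangent:
  assumes "embedded_submanifold M" "metric_operator M g" "x \<in> M" "\<xi> \<in> tangent_space M x"
  shows "tangent_proj M g x \<xi> = \<xi>"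
proof -
  let ?d = "\<xi> - tangent_proj M g x \<xi>"
  have "?d \<in> tangent_space M x"
    using subspace_diff[OF subspace_tangent_space[OF assms(1,3)] assms(4) tangent_proj_mem[OF assms(1-3)]] .
  then have "?d \<bullet> g x ?d = 0"
    by (rule tangent_proj_orthogonal[OF assms(1-3)])
  then have "?d = 0"
    using metric_operator_nondegenerate[OF assms(2,3)] by blast
  then show ?thesis
    by simp
qed

text \<open>Every tangent vector extends to a global vector field, by projecting a constant one. This makes
  the value that defines \<^const>\<open>riem_curv\<close> unique.\<close>

lemma vector_field_through:
  assumes "embedded_submanifold M" "metric_operator M g" "x \<in> M" "\<xi> \<in> tangent_space M x"
  obtains X where "vector_field M X" "X x = \<xi>"
proof (rule that[of "\<lambda>y. tangent_proj M g y \<xi>"])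
  show "vector_field M (\<lambda>y. tangent_proj M g y \<xi>)"
    unfolding vector_field_def
    using smooth_on_mfd_bilinear[OF bounded_bilinear_blinfun_apply smooth_tangent_proj[OF assms(1,2)]
        smooth_on_mfd_const[of M \<xi>]] tangent_proj_mem[OF assms(1,2)] by blast
qed (rule tangent_proj_tangent[OF assms])

section \<open>Commutators and the Lie bracket\<close>

text \<open>For functions and fields given on \<open>M\<close> only: the maps \<open>f'\<close> and \<open>D\<close> are the first and second
  derivative at \<open>x\<close> of a local extension of \<open>f\<close>, and the same \<open>D\<close> serves all fields.\<close>

lemma iterated_dir_deriv:
  assumes "smooth_on_mfd M f" "x \<in> M"
  obtains f' D where "linear f'" "\<And>v. v \<in> tangent_space M x \<Longrightarrow> dir_deriv M f x v = f' v"
    "\<And>v w. D v w = D w v"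
    "\<And>Y Y'. vector_field M Y \<Longrightarrow> (Y has_derivative Y') (at x within M) \<Longrightarrow>
      ((\<lambda>y. dir_deriv M f y (Y y)) has_derivative (\<lambda>h. f' (Y' h) + D h (Y x))) (at x within M)"
proof -
  from assms obtain U F where U: "open U" "x \<in> U" "smooth_on_open F U"
    "\<And>y. y \<in> U \<Longrightarrow> y \<in> M \<Longrightarrow> F y = f y"
    by (rule smooth_on_mfdE) (rule that)
  have dF: "(f has_derivative frechet_derivative F (at y)) (at y within M)" if "y \<in> U" "y \<in> M" for y
    using has_derivative_at_withinI[OF smooth_on_open_has_derivative[OF U(3) that(1)]] U(1) that U(4)
    by (rule has_derivative_of_extension)
  have dd: "dir_deriv M f y v = frechet_derivative F (at y) v"
    if "y \<in> U" "y \<in> M" "v \<in> tangent_space M y" for y v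
    using dF[OF that(1,2)] that(3) by (rule dir_deriv_eq)
  from U(3,2) obtain D where D: "\<And>v w. D v w = D w v"
    "\<And>Y Y' S. (Y has_derivative Y') (at x within S) \<Longrightarrow>
      ((\<lambda>y. frechet_derivative F (at y) (Y y)) has_derivative
        (\<lambda>h. frechet_derivative F (at x) (Y' h) + D h (Y x))) (at x within S)"
    by (rule iterated_directional_derivative) (rule that)
  show thesis
  proof (rule that[of "frechet_derivative F (at x)" D])
    show "linear (frechet_derivative F (at x))"
      using dF[OF U(2) assms(2)] by (rule has_derivative_linear)
    show "dir_deriv M f x v = frechet_derivative F (at x) v" if "v \<in> tangent_space M x" for v
      using dd[OF U(2) assms(2) that] .
    show "D v w = D w v" for v w
      by (rule D(1))
    fix Y Y' assume Y: "vector_field M Y" "(Y has_derivative Y') (at x within M)"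
    have "frechet_derivative F (at y) (Y y) = dir_deriv M f y (Y y)" if "y \<in> U" "y \<in> M" for y
      using dd[OF that] Y(1) that(2) by (simp add: vector_field_def)
    with D(2)[OF Y(2)] U(1,2) assms(2)
    show "((\<lambda>y. dir_deriv M f y (Y y)) has_derivative
        (\<lambda>h. frechet_derivative F (at x) (Y' h) + D h (Y x))) (at x within M)"
      by (rule has_derivative_of_extension)
  qed
qed

lemma vector_field_differentiable:
  assumes "vector_field M X" "x \<in> M"
  shows "X differentiable (at x within M)"
  using assms smooth_on_mfd_differentiable unfolding vector_field_def by blast

lemma vector_field_tangent:
  assumes "vector_field M X" "x \<in> M"
  shows "X x \<in> tangent_space M x"
  using assms unfolding vector_field_def by blast

lemma dir_deriv_field_differentiable:
  assumes "smooth_on_mfd M f" "vector_field M Y" "x \<in> M"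
  shows "(\<lambda>y. dir_deriv M f y (Y y)) differentiable (at x within M)"
proof -
  obtain Y' where Y': "(Y has_derivative Y') (at x within M)"
    using vector_field_differentiable[OF assms(2,3)] unfolding differentiable_def by (elim exE)
  from assms(1,3) show ?thesis
  proof (rule iterated_dir_deriv)
    fix f' D
    assume D: "\<And>Y Y'. vector_field M Y \<Longrightarrow> (Y has_derivative Y') (at x within M) \<Longrightarrow>
      ((\<lambda>y. dir_deriv M f y (Y y)) has_derivative (\<lambda>h. f' (Y' h) + D h (Y x))) (at x within M)"
    show ?thesis
      using D[OF assms(2) Y'] by (rule differentiableI)
  qed
qed

text \<open>If \<open>F\<close> is a local equation of \<open>M\<close>, then \<open>D\<^sub>X F\<close> and \<open>D\<^sub>Y F\<close> vanish on \<open>M\<close> near \<open>x\<close>. Differentiating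
  once more, along \<open>Y\<close> and \<open>X\<close>, and subtracting, the symmetric second-order terms cancel and the
  derivative of \<open>F\<close> is left to annihilate \<open>D\<^sub>X Y - D\<^sub>Y X\<close>.\<close>

lemma commutator_tangent:
  fixes M :: "'e::euclidean_space set"
  assumes "embedded_submanifold M" "vector_field M X" "vector_field M Y" "x \<in> M"
  shows "dir_deriv M Y x (X x) - dir_deriv M X x (Y x) \<in> tangent_space M x"
  using assms(1,4)
proof (rule embedded_submanifold_frame)
  fix U and F :: "'e \<Rightarrow> 'e"
  assume U: "open U" "x \<in> U" "smooth_on_open F U"
    "\<And>y. y \<in> U \<Longrightarrow> y \<in> M \<Longrightarrow> tangent_space M y = {v. frechet_derivative F (at y) v = 0}"
  obtain X' Y' where d: "(X has_derivative X') (at x within M)" "(Y has_derivative Y') (at x within M)"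
    using vector_field_differentiable[OF assms(2,4)] vector_field_differentiable[OF assms(3,4)]
    unfolding differentiable_def by (elim exE)
  from U(3,2) obtain D where D: "\<And>v w. D v w = D w v"
    "\<And>Y Y' S. (Y has_derivative Y') (at x within S) \<Longrightarrow>
      ((\<lambda>y. frechet_derivative F (at y) (Y y)) has_derivative
        (\<lambda>h. frechet_derivative F (at x) (Y' h) + D h (Y x))) (at x within S)"
    by (rule iterated_directional_derivative) (rule that)
  \<comment> \<open>The derivative of \<open>D\<^sub>Z F\<close>, which is zero on \<open>M\<close>, in a tangent direction \<open>v\<close>.\<close>
  have zero: "frechet_derivative F (at x) (Z' v) + D v (Z x) = 0"
    if Z: "vector_field M Z" "(Z has_derivative Z') (at x within M)" and v: "v \<in> tangent_space M x" for Z Z' v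
  proof (rule has_derivative_zero_on[OF D(2)[OF Z(2)] U(1,2) assms(4) _ v])
    show "frechet_derivative F (at y) (Z y) = 0" if "y \<in> U" "y \<in> M" for y
      using U(4)[OF that] vector_field_tangent[OF Z(1) that(2)] by blast
  qed
  have "frechet_derivative F (at x) (Y' (X x) - X' (Y x))
      = frechet_derivative F (at x) (Y' (X x)) - frechet_derivative F (at x) (X' (Y x))"
    using has_derivative_linear[OF smooth_on_open_has_derivative[OF U(3,2)]] by (rule linear_diff)
  also have "\<dots> = 0"
    using zero[OF assms(3) d(2) vector_field_tangent[OF assms(2,4)]]
      zero[OF assms(2) d(1) vector_field_tangent[OF assms(3,4)]] D(1)[of "X x" "Y x"]
    by (metis add_right_cancel cancel_comm_monoid_add_class.diff_cancel)
  finally show ?thesis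
    using U(4)[OF U(2) assms(4)] dir_deriv_eq[OF d(1) vector_field_tangent[OF assms(3,4)]]
      dir_deriv_eq[OF d(2) vector_field_tangent[OF assms(2,4)]] by simp
qed

text \<open>The second-order terms of \<open>D\<^sub>X (D\<^sub>Y f)\<close> and \<open>D\<^sub>Y (D\<^sub>X f)\<close> agree by symmetry. The codomain of \<open>f\<close>
  is arbitrary: real-valued \<open>f\<close> identify the Lie bracket, vector-valued ones enter the curvature,
  and operator-valued ones the variant with the tangent projection.\<close>

lemma dir_deriv_commutator:
  assumes "embedded_submanifold M" "smooth_on_mfd M f" "vector_field M X" "vector_field M Y" "x \<in> M"
  shows "dir_deriv M (\<lambda>y. dir_deriv M f y (Y y)) x (X x) - dir_deriv M (\<lambda>y. dir_deriv M f y (X y)) x (Y x)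
    = dir_deriv M f x (dir_deriv M Y x (X x) - dir_deriv M X x (Y x))"
  using assms(2,5)
proof (rule iterated_dir_deriv)
  fix f' D
  assume f': "linear f'" "\<And>v. v \<in> tangent_space M x \<Longrightarrow> dir_deriv M f x v = f' v"
    and D_sym: "\<And>v w. D v w = D w v"
    and D: "\<And>Y Y'. vector_field M Y \<Longrightarrow> (Y has_derivative Y') (at x within M) \<Longrightarrow>
      ((\<lambda>y. dir_deriv M f y (Y y)) has_derivative (\<lambda>h. f' (Y' h) + D h (Y x))) (at x within M)"
  obtain X' Y' where d: "(X has_derivative X') (at x within M)" "(Y has_derivative Y') (at x within M)"
    using vector_field_differentiable[OF assms(3,5)] vector_field_differentiable[OF assms(4,5)]
    unfolding differentiable_def by (elim exE)
  note X = vector_field_tangent[OF assms(3,5)] and Y = vector_field_tangent[OF assms(4,5)]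
  note XY = dir_deriv_eq[OF D[OF assms(4) d(2)] X] and YX = dir_deriv_eq[OF D[OF assms(3) d(1)] Y]
  have "dir_deriv M f x (dir_deriv M Y x (X x) - dir_deriv M X x (Y x))
      = f' (dir_deriv M Y x (X x) - dir_deriv M X x (Y x))"
    using f'(2)[OF commutator_tangent[OF assms(1,3,4,5)]] .
  also have "\<dots> = f' (Y' (X x)) - f' (X' (Y x))"
    using dir_deriv_eq[OF d(1) Y] dir_deriv_eq[OF d(2) X] linear_diff[OF f'(1)] by simp
  also have "\<dots> = (f' (Y' (X x)) + D (X x) (Y x)) - (f' (X' (Y x)) + D (Y x) (X x))"
    using D_sym[of "X x" "Y x"] by simp
  finally show ?thesis
    unfolding XY YX by (rule sym)
qed

text \<open>The commutator of derivations determines a tangent vector because the coordinate functions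
  of the ambient space are smooth on \<open>M\<close>.\<close>

lemma lie_bracket_eq:
  assumes "embedded_submanifold M" "vector_field M X" "vector_field M Y" "x \<in> M"
  shows "lie_bracket M X Y x = dir_deriv M Y x (X x) - dir_deriv M X x (Y x)"
  unfolding lie_bracket_def
proof (rule the_equality)
  let ?w = "dir_deriv M Y x (X x) - dir_deriv M X x (Y x)"
  note comm = dir_deriv_commutator[OF assms(1) _ assms(2-4)]
  have tan: "?w \<in> tangent_space M x"
    using assms by (rule commutator_tangent)
  show "?w \<in> tangent_space M x \<and> (\<forall>f::'a \<Rightarrow> real. smooth_on_mfd M f \<longrightarrow>
      dir_deriv M f x ?w = dir_deriv M (\<lambda>y. dir_deriv M f y (Y y)) x (X x)
                         - dir_deriv M (\<lambda>y. dir_deriv M f y (X y)) x (Y x))"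
    by (simp add: tan comm)
  fix w
  assume w: "w \<in> tangent_space M x \<and> (\<forall>f::'a \<Rightarrow> real. smooth_on_mfd M f \<longrightarrow>
      dir_deriv M f x w = dir_deriv M (\<lambda>y. dir_deriv M f y (Y y)) x (X x)
                         - dir_deriv M (\<lambda>y. dir_deriv M f y (X y)) x (Y x))"
  show "w = ?w"
  proof (rule euclidean_eqI)
    fix b :: 'a
    have smooth: "smooth_on_mfd M (\<lambda>y. y \<bullet> b)"
      using bounded_linear_inner_left smooth_on_mfd_ident by (rule smooth_on_mfd_linear)
    have "((\<lambda>y. y \<bullet> b) has_derivative (\<lambda>v. v \<bullet> b)) (at x within M)"
      using has_derivative_ident by (rule has_derivative_inner_left)
    then have coord: "dir_deriv M (\<lambda>y. y \<bullet> b) x v = v \<bullet> b" if "v \<in> tangent_space M x" for v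
      using that by (rule dir_deriv_eq)
    have "dir_deriv M (\<lambda>y. y \<bullet> b) x w = dir_deriv M (\<lambda>y. y \<bullet> b) x ?w"
      using w smooth comm[OF smooth] by simp
    then show "w \<bullet> b = ?w \<bullet> b"
      using coord[OF tan] coord[of w] w by simp
  qed
qed

section \<open>Curvature of the Levi-Civita connection\<close>

lemma affine_connection_vector_field:
  assumes "affine_connection M nabla" "vector_field M X" "vector_field M Y"
  shows "vector_field M (nabla X Y)"
proof -
  have "\<forall>X Y. vector_field M X \<longrightarrow> vector_field M Y \<longrightarrow> vector_field M (nabla X Y)"
    using assms(1) unfolding affine_connection_def by (elim conjE)
  then show ?thesis
    using assms(2,3) by simp
qed

lemma levi_civita_torsion_free:
  assumes "levi_civita M g nabla" "vector_field M X" "vector_field M Y" "x \<in> M"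
  shows "nabla X Y x - nabla Y X x = lie_bracket M X Y x"
proof -
  have "\<forall>X Y. vector_field M X \<longrightarrow> vector_field M Y \<longrightarrow>
      (\<forall>x\<in>M. nabla X Y x - nabla Y X x = lie_bracket M X Y x)"
    using assms(1) unfolding levi_civita_def by (elim conjE)
  then show ?thesis
    using assms(2-4) by simp
qed

lemma vector_field_lie_bracket:
  assumes "embedded_submanifold M" "levi_civita M g nabla" "vector_field M X" "vector_field M Y"
  shows "vector_field M (lie_bracket M X Y)"
proof -
  have conn: "affine_connection M nabla"
    using assms(2) by (simp add: levi_civita_def)
  have "smooth_on_mfd M (nabla X Y)" "smooth_on_mfd M (nabla Y X)"
    using affine_connection_vector_field[OF conn assms(3,4)] affine_connection_vector_field[OF conn assms(4,3)]
    by (simp_all add: vector_field_def)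
  then have "smooth_on_mfd M (\<lambda>x. nabla X Y x - nabla Y X x)"
    by (rule smooth_on_mfd_diff)
  then have "smooth_on_mfd M (lie_bracket M X Y)"
    using levi_civita_torsion_free[OF assms(2-4)] by (rule smooth_on_mfd_cong)
  then show ?thesis
    unfolding vector_field_def
    using lie_bracket_eq[OF assms(1,3,4)] commutator_tangent[OF assms(1,3,4)] by simp
qed

text \<open>Substitution of the Christoffel formula into itself, expanded by the Leibniz rule; the result
  keeps the derivatives of the fields \<open>Y\<close> and \<open>Z\<close>, which cancel only in the curvature.\<close>

lemma second_covariant_derivative:
  assumes "christoffel_function M nabla \<Gamma>" "affine_connection M nabla"
    and "vector_field M X" "vector_field M Y" "vector_field M Z" "x \<in> M"
  shows "nabla X (nabla Y Z) x =
      dir_deriv M (\<lambda>y. dir_deriv M Z y (Y y)) x (X x)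
      + dir_deriv M \<Gamma> x (X x) (Y x) (Z x) + \<Gamma> x (dir_deriv M Y x (X x)) (Z x)
      + \<Gamma> x (Y x) (dir_deriv M Z x (X x))
      + \<Gamma> x (X x) (dir_deriv M Z x (Y x)) + \<Gamma> x (X x) (\<Gamma> x (Y x) (Z x))"
proof -
  have eq: "nabla V W y = dir_deriv M W y (V y) + \<Gamma> y (V y) (W y)"
    if "vector_field M V" "vector_field M W" "y \<in> M" for V W y
    using assms(1) that by (simp add: christoffel_function_def)
  have YZ: "vector_field M (nabla Y Z)"
    using assms(2,4,5) by (rule affine_connection_vector_field)
  have smooth: "smooth_on_mfd M \<Gamma>" "smooth_on_mfd M Z"
    using assms(1,5) by (simp_all add: christoffel_function_def vector_field_def)
  note X = vector_field_tangent[OF assms(3,6)]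
  note dY = vector_field_differentiable[OF assms(4,6)] and dZ = vector_field_differentiable[OF assms(5,6)]
    and dG = smooth_on_mfd_differentiable[OF smooth(1) assms(6)]
  note dGY = differentiable_bilinear[OF bounded_bilinear_blinfun_apply dG dY]
  note dGYZ = differentiable_bilinear[OF bounded_bilinear_blinfun_apply dGY dZ]
  note dDZ = dir_deriv_field_differentiable[OF smooth(2) assms(4,6)]
  have "dir_deriv M (nabla Y Z) x (X x) =
      dir_deriv M (\<lambda>y. dir_deriv M Z y (Y y) + \<Gamma> y (Y y) (Z y)) x (X x)"
    using eq[OF assms(4,5)] by (rule dir_deriv_cong)
  also have "\<dots> = dir_deriv M (\<lambda>y. dir_deriv M Z y (Y y)) x (X x)
      + dir_deriv M (\<lambda>y. \<Gamma> y (Y y) (Z y)) x (X x)"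
    using dDZ dGYZ X by (rule dir_deriv_add)
  also have "dir_deriv M (\<lambda>y. \<Gamma> y (Y y) (Z y)) x (X x) = \<Gamma> x (Y x) (dir_deriv M Z x (X x))
      + dir_deriv M (\<lambda>y. \<Gamma> y (Y y)) x (X x) (Z x)"
    using bounded_bilinear_blinfun_apply dGY dZ X by (rule dir_deriv_bilinear)
  also have "dir_deriv M (\<lambda>y. \<Gamma> y (Y y)) x (X x) = \<Gamma> x (dir_deriv M Y x (X x)) + dir_deriv M \<Gamma> x (X x) (Y x)"
    using bounded_bilinear_blinfun_apply dG dY X by (rule dir_deriv_bilinear)
  finally show ?thesis
    unfolding eq[OF assms(3) YZ assms(6)] eq[OF assms(4,5,6)]
    by (simp add: blinfun.add_left blinfun.add_right)
qed

text \<open>Subtracting the second covariant derivatives, the terms \<open>\<Gamma> (Y, D\<^sub>X Z)\<close> and \<open>\<Gamma> (X, D\<^sub>Y Z)\<close> cancel in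
  pairs, and the bracket absorbs the commutator of \<open>D\<^sub>X\<close> and \<open>D\<^sub>Y\<close> on \<open>Z\<close> together with the terms
  \<open>\<Gamma> (D\<^sub>X Y, Z)\<close> and \<open>\<Gamma> (D\<^sub>Y X, Z)\<close>. What remains depends on the values of the fields at \<open>x\<close> only.\<close>

lemma curvature_of_fields:
  assumes "embedded_submanifold M" "levi_civita M g nabla" "christoffel_function M nabla \<Gamma>"
    and "vector_field M X" "vector_field M Y" "vector_field M Z" "x \<in> M"
  shows "nabla (lie_bracket M X Y) Z x - nabla X (nabla Y Z) x + nabla Y (nabla X Z) x =
      - dir_deriv M \<Gamma> x (X x) (Y x) (Z x) + dir_deriv M \<Gamma> x (Y x) (X x) (Z x)
      - \<Gamma> x (X x) (\<Gamma> x (Y x) (Z x)) + \<Gamma> x (Y x) (\<Gamma> x (X x) (Z x))"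
proof -
  have conn: "affine_connection M nabla"
    using assms(2) by (simp add: levi_civita_def)
  let ?w = "dir_deriv M Y x (X x) - dir_deriv M X x (Y x)"
  have "nabla (lie_bracket M X Y) Z x = dir_deriv M Z x (lie_bracket M X Y x) + \<Gamma> x (lie_bracket M X Y x) (Z x)"
    using assms(3,6,7) vector_field_lie_bracket[OF assms(1,2,4,5)]
    by (simp add: christoffel_function_def)
  also have "\<dots> = dir_deriv M Z x ?w + \<Gamma> x ?w (Z x)"
    by (simp only: lie_bracket_eq[OF assms(1,4,5,7)])
  also have "dir_deriv M Z x ?w = dir_deriv M (\<lambda>y. dir_deriv M Z y (Y y)) x (X x)
      - dir_deriv M (\<lambda>y. dir_deriv M Z y (X y)) x (Y x)"
    using dir_deriv_commutator[OF assms(1) _ assms(4,5,7), of Z] assms(6)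
    by (simp add: vector_field_def)
  finally show ?thesis
    unfolding second_covariant_derivative[OF assms(3) conn assms(4,5,6,7)]
      second_covariant_derivative[OF assms(3) conn assms(5,4,6,7)]
    by (simp add: blinfun.diff_left blinfun.diff_right)
qed

lemma riem_curv_eq:
  assumes "embedded_submanifold M" "metric_operator M g" "levi_civita M g nabla"
    and "christoffel_function M nabla \<Gamma>" "x \<in> M"
    and "\<xi> \<in> tangent_space M x" "\<eta> \<in> tangent_space M x" "\<phi> \<in> tangent_space M x"
  shows "riem_curv M nabla x \<xi> \<eta> \<phi> =
           - dir_deriv M \<Gamma> x \<xi> \<eta> \<phi> + dir_deriv M \<Gamma> x \<eta> \<xi> \<phi>
           - \<Gamma> x \<xi> (\<Gamma> x \<eta> \<phi>) + \<Gamma> x \<eta> (\<Gamma> x \<xi> \<phi>)"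
  unfolding riem_curv_def
proof (rule the_equality)
  let ?r = "- dir_deriv M \<Gamma> x \<xi> \<eta> \<phi> + dir_deriv M \<Gamma> x \<eta> \<xi> \<phi>
           - \<Gamma> x \<xi> (\<Gamma> x \<eta> \<phi>) + \<Gamma> x \<eta> (\<Gamma> x \<xi> \<phi>)"
  let ?R = "\<lambda>X Y Z. nabla (lie_bracket M X Y) Z x - nabla X (nabla Y Z) x + nabla Y (nabla X Z) x"
  have R: "?R X Y Z = ?r" if "vector_field M X" "vector_field M Y" "vector_field M Z"
    "X x = \<xi>" "Y x = \<eta>" "Z x = \<phi>" for X Y Z
    using curvature_of_fields[OF assms(1,3,4) that(1-3) assms(5)] that(4-6) by simp
  then show "\<forall>X Y Z. vector_field M X \<longrightarrow> vector_field M Y \<longrightarrow> vector_field M Z \<longrightarrow>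
      X x = \<xi> \<longrightarrow> Y x = \<eta> \<longrightarrow> Z x = \<phi> \<longrightarrow> ?r = ?R X Y Z"
    by simp
  fix r
  assume r: "\<forall>X Y Z. vector_field M X \<longrightarrow> vector_field M Y \<longrightarrow> vector_field M Z \<longrightarrow>
      X x = \<xi> \<longrightarrow> Y x = \<eta> \<longrightarrow> Z x = \<phi> \<longrightarrow> r = ?R X Y Z"
  obtain X where X: "vector_field M X" "X x = \<xi>"
    using vector_field_through[OF assms(1,2,5,6)] .
  obtain Y where Y: "vector_field M Y" "Y x = \<eta>"
    using vector_field_through[OF assms(1,2,5,7)] .
  obtain Z where Z: "vector_field M Z" "Z x = \<phi>"
    using vector_field_through[OF assms(1,2,5,8)] .
  have "r = ?R X Y Z"
    using r X Y Z by blast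
  then show "r = ?r"
    using R[OF X(1) Y(1) Z(1) X(2) Y(2) Z(2)] by (rule trans)
qed

text \<open>For fields \<open>X\<close>, \<open>Y\<close> through \<open>\<xi>\<close>, \<open>\<eta>\<close> the defining identity of \<open>\<Gamma>r\<close> holds along \<open>Y\<close> and can be
  differentiated along \<open>X\<close>, and conversely. In the difference, the second derivatives of the
  tangent projection combine into its derivative along \<open>D\<^sub>X Y - D\<^sub>Y X\<close>, which cancels by
  the same identity since this vector is tangent.\<close>

lemma ring_christoffel_antisymmetrized_derivative:
  assumes "embedded_submanifold M" "metric_operator M g" "smooth_on_mfd M \<Gamma>"
    and "ring_christoffel M g \<Gamma> \<Gamma>r" "x \<in> M" "\<xi> \<in> tangent_space M x" "\<eta> \<in> tangent_space M x"
  shows "dir_deriv M \<Gamma>r x \<xi> \<eta> - dir_deriv M \<Gamma>r x \<eta> \<xi> = dir_deriv M \<Gamma> x \<xi> \<eta> - dir_deriv M \<Gamma> x \<eta> \<xi>"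
proof -
  obtain X where X: "vector_field M X" "X x = \<xi>"
    using vector_field_through[OF assms(1,2,5,6)] .
  obtain Y where Y: "vector_field M Y" "Y x = \<eta>"
    using vector_field_through[OF assms(1,2,5,7)] .
  let ?P = "tangent_proj M g"
  have P: "smooth_on_mfd M ?P"
    using assms(1,2) by (rule smooth_tangent_proj)
  have dG: "\<Gamma> differentiable (at x within M)"
    using assms(3,5) by (rule smooth_on_mfd_differentiable)
  have dGr: "\<Gamma>r differentiable (at x within M)"
    using assms(4,5) by (intro smooth_on_mfd_differentiable) (auto simp: ring_christoffel_def)
  have ring: "\<Gamma>r y v = dir_deriv M ?P y v + \<Gamma> y v" if "y \<in> M" "v \<in> tangent_space M y" for y v
    using assms(4) that by (intro blinfun_eqI) (simp add: ring_christoffel_def blinfun.add_left)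
  have step: "\<Gamma>r x (dir_deriv M W x v) + dir_deriv M \<Gamma>r x v (W x) =
      dir_deriv M (\<lambda>y. dir_deriv M ?P y (W y)) x v + \<Gamma> x (dir_deriv M W x v) + dir_deriv M \<Gamma> x v (W x)"
    if W: "vector_field M W" and v: "v \<in> tangent_space M x" for W v
  proof -
    note dW = vector_field_differentiable[OF W assms(5)]
    have "\<Gamma>r x (dir_deriv M W x v) + dir_deriv M \<Gamma>r x v (W x) = dir_deriv M (\<lambda>y. \<Gamma>r y (W y)) x v"
      using dir_deriv_bilinear[OF bounded_bilinear_blinfun_apply dGr dW v] by (rule sym)
    also have "\<dots> = dir_deriv M (\<lambda>y. dir_deriv M ?P y (W y) + \<Gamma> y (W y)) x v"
      using ring vector_field_tangent[OF W] by (intro dir_deriv_cong) blast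
    also have "\<dots> = dir_deriv M (\<lambda>y. dir_deriv M ?P y (W y)) x v + dir_deriv M (\<lambda>y. \<Gamma> y (W y)) x v"
      using dir_deriv_field_differentiable[OF P W assms(5)]
        differentiable_bilinear[OF bounded_bilinear_blinfun_apply dG dW] v
      by (rule dir_deriv_add)
    also have "dir_deriv M (\<lambda>y. \<Gamma> y (W y)) x v = \<Gamma> x (dir_deriv M W x v) + dir_deriv M \<Gamma> x v (W x)"
      using bounded_bilinear_blinfun_apply dG dW v by (rule dir_deriv_bilinear)
    finally show ?thesis
      by (simp only: add.assoc)
  qed
  let ?w = "dir_deriv M Y x \<xi> - dir_deriv M X x \<eta>"
  have "?w \<in> tangent_space M x"
    using commutator_tangent[OF assms(1) X(1) Y(1) assms(5)] X(2) Y(2) by simp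
  then have "\<Gamma>r x ?w = dir_deriv M ?P x ?w + \<Gamma> x ?w"
    by (rule ring[OF assms(5)])
  moreover have "dir_deriv M ?P x ?w = dir_deriv M (\<lambda>y. dir_deriv M ?P y (Y y)) x \<xi>
      - dir_deriv M (\<lambda>y. dir_deriv M ?P y (X y)) x \<eta>"
    using dir_deriv_commutator[OF assms(1) P X(1) Y(1) assms(5)] X(2) Y(2) by simp
  ultimately have w: "\<Gamma>r x ?w = dir_deriv M (\<lambda>y. dir_deriv M ?P y (Y y)) x \<xi>
      - dir_deriv M (\<lambda>y. dir_deriv M ?P y (X y)) x \<eta> + \<Gamma> x ?w"
    by simp
  have "dir_deriv M \<Gamma>r x \<xi> \<eta> - dir_deriv M \<Gamma>r x \<eta> \<xi> =
      (\<Gamma>r x (dir_deriv M Y x \<xi>) + dir_deriv M \<Gamma>r x \<xi> (Y x))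
      - (\<Gamma>r x (dir_deriv M X x \<eta>) + dir_deriv M \<Gamma>r x \<eta> (X x)) - \<Gamma>r x ?w"
    by (simp add: X(2) Y(2) blinfun.diff_right)
  also have "\<dots> = dir_deriv M \<Gamma> x \<xi> \<eta> - dir_deriv M \<Gamma> x \<eta> \<xi>"
    unfolding step[OF Y(1) assms(6)] step[OF X(1) assms(7)] w
    by (simp add: X(2) Y(2) blinfun.diff_right)
  finally show ?thesis .
qed

theorem theorem5p1:
  fixes M :: "'e::euclidean_space set"
    and g :: "'e \<Rightarrow> 'e \<Rightarrow>\<^sub>L 'e"
    and nabla :: "('e \<Rightarrow> 'e) \<Rightarrow> ('e \<Rightarrow> 'e) \<Rightarrow> 'e \<Rightarrow> 'e"
    and \<Gamma> :: "'e \<Rightarrow> 'e \<Rightarrow>\<^sub>L 'e \<Rightarrow>\<^sub>L 'e"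
    and x \<xi> \<eta> \<phi> :: 'e
  assumes "embedded_submanifold M"
    and "metric_operator M g"
    and "levi_civita M g nabla"
    and "christoffel_function M nabla \<Gamma>"
    and "x \<in> M"
    and "\<xi> \<in> tangent_space M x" and "\<eta> \<in> tangent_space M x" and "\<phi> \<in> tangent_space M x"
  shows "riem_curv M nabla x \<xi> \<eta> \<phi> =
           - dir_deriv M \<Gamma> x \<xi> \<eta> \<phi> + dir_deriv M \<Gamma> x \<eta> \<xi> \<phi>
           - \<Gamma> x \<xi> (\<Gamma> x \<eta> \<phi>) + \<Gamma> x \<eta> (\<Gamma> x \<xi> \<phi>)
       \<and> (christoffel_symmetric_at M \<Gamma> x \<longrightarrow>
          riem_curv M nabla x \<xi> \<eta> \<phi> =
           - dir_deriv M \<Gamma> x \<xi> \<eta> \<phi> + dir_deriv M \<Gamma> x \<eta> \<xi> \<phi>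
           - \<Gamma> x (\<Gamma> x \<phi> \<eta>) \<xi> + \<Gamma> x (\<Gamma> x \<phi> \<xi>) \<eta>)
       \<and> (\<forall>\<Gamma>r. ring_christoffel M g \<Gamma> \<Gamma>r \<longrightarrow>
          riem_curv M nabla x \<xi> \<eta> \<phi> =
           - dir_deriv M \<Gamma>r x \<xi> \<eta> \<phi> + dir_deriv M \<Gamma>r x \<eta> \<xi> \<phi>
           - \<Gamma> x \<xi> (\<Gamma> x \<eta> \<phi>) + \<Gamma> x \<eta> (\<Gamma> x \<xi> \<phi>))"
proof (intro conjI impI allI)
  show formula: "riem_curv M nabla x \<xi> \<eta> \<phi> =
           - dir_deriv M \<Gamma> x \<xi> \<eta> \<phi> + dir_deriv M \<Gamma> x \<eta> \<xi> \<phi>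
           - \<Gamma> x \<xi> (\<Gamma> x \<eta> \<phi>) + \<Gamma> x \<eta> (\<Gamma> x \<xi> \<phi>)"
    using assms by (rule riem_curv_eq)
  show "riem_curv M nabla x \<xi> \<eta> \<phi> =
           - dir_deriv M \<Gamma> x \<xi> \<eta> \<phi> + dir_deriv M \<Gamma> x \<eta> \<xi> \<phi>
           - \<Gamma> x (\<Gamma> x \<phi> \<eta>) \<xi> + \<Gamma> x (\<Gamma> x \<phi> \<xi>) \<eta>"
    if "christoffel_symmetric_at M \<Gamma> x"
  proof -
    have sym: "\<Gamma> x \<omega> \<zeta> = \<Gamma> x \<zeta> \<omega>" if "\<zeta> \<in> tangent_space M x" for \<zeta> \<omega>
      using \<open>christoffel_symmetric_at M \<Gamma> x\<close> that unfolding christoffel_symmetric_at_def by blast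
    show ?thesis
      by (simp only: formula sym[OF assms(6), of "\<Gamma> x \<eta> \<phi>"] sym[OF assms(7), of "\<Gamma> x \<xi> \<phi>"]
          sym[OF assms(6), of \<phi>] sym[OF assms(7), of \<phi>])
  qed
  fix \<Gamma>r
  assume ring: "ring_christoffel M g \<Gamma> \<Gamma>r"
  have "smooth_on_mfd M \<Gamma>"
    using assms(4) by (simp add: christoffel_function_def)
  from ring_christoffel_antisymmetrized_derivative[OF assms(1,2) this ring assms(5,6,7)]
  have "dir_deriv M \<Gamma>r x \<xi> \<eta> \<phi> - dir_deriv M \<Gamma>r x \<eta> \<xi> \<phi>
      = dir_deriv M \<Gamma> x \<xi> \<eta> \<phi> - dir_deriv M \<Gamma> x \<eta> \<xi> \<phi>"
    by (metis blinfun.diff_left)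
  then show "riem_curv M nabla x \<xi> \<eta> \<phi> =
           - dir_deriv M \<Gamma>r x \<xi> \<eta> \<phi> + dir_deriv M \<Gamma>r x \<eta> \<xi> \<phi>
           - \<Gamma> x \<xi> (\<Gamma> x \<eta> \<phi>) + \<Gamma> x \<eta> (\<Gamma> x \<xi> \<phi>)"
    unfolding formula by (simp add: algebra_simps)
qed

end
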